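(* (i) There are exactly 39 equivalence classes of marginal positive-entropy sets of Wang tiles in $\Sigma_{2\times 2}(2)$, namely the equivalence classes of the following sets (tiles denoted by their numbers $1,\dots,16$): $\{1,2,5\}$, $\{1,3,5,10\}$, $\{1,3,6,14\}$, $\{1,4,5,10\}$, $\{1,5,6,12\}$, $\{1,6,7,10\}$, $\{2,3,5,9\}$, $\{2,3,5,10\}$, $\{2,3,5,14\}$, $\{2,4,5,10\}$, $\{2,5,7,10\}$, $\{4,5,10,12\}$, $\{1,3,5,12,13\}$, $\{1,3,5,12,14\}$, $\{1,3,6,12,13\}$, $\{1,3,7,12,13\}$, $\{1,4,5,12,14\}$, $\{1,4,5,14,15\}$, $\{1,4,5,14,16\}$, $\{1,4,7,10,13\}$, $\{1,5,7,8,10\}$, $\{1,5,7,10,12\}$, $\{1,5,7,12,14\}$, $\{1,6,7,12,13\}$, $\{1,7,10,12,13\}$, $\{1,7,10,12,14\}$, $\{1,7,12,13,14\}$, $\{3,4,5,7,10\}$, $\{3,4,5,8,10\}$, $\{3,4,5,10,15\}$, $\{3,5,7,8,10\}$, $\{3,5,7,10,12\}$, $\{3,5,8,10,12\}$, $\{3,5,8,10,15\}$, $\{3,5,10,12,13\}$, $\{3,5,10,12,14\}$, $\{4,5,7,9,10\}$, $\{4,5,7,10,13\}$, $\{4,5,7,10,15\}$. (ii) There are exactly 18 equivalence classes of saturated zero-entropy sets of Wang tiles in $\Sigma_{2\times2}(2)$, namely the equivalence classes of the following sets: $\{1,4,5,14\}$, $\{1,5,12,15\}\cup\{9,10,13,14\}$,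 $\{1,5,12,16\}\cup\{9,10,13,14\}$, $\{1,6,11,16\}\cup\{2,3,4,7,8,12\}$, $\{1,6,12,15\}\cup\{9,10,13,14\}$, $\{1,7,10,16\}\cup\{2,3,4,8,12\}$, $\{1,7,12,13\}$, $\{1,7,12,14\}$, $\{2,5,12,15\}\cup\{9,10,13,14\}$, $\{3,4,5,10\}$, $\{3,5,7,10\}$, $\{3,5,8,10\}$, $\{3,5,10,12\}$, $\{3,5,12,14\}$, $\{4,5,7,10\}$, $\{4,5,10,15\}$, $\{4,7,10,13\}$, $\{5,7,10,12\}$.
   Context: A Wang tile with two symbols is a unit square with colored edges, identified with the quadruple $B=(b(B),l(B),t(B),r(B))\in\{0,1\}^4$ of the colors of its bottom, left, top and right edges. $\Sigma_{2\times 2}(2)$ is the set of all 16 such tiles. The tile with $(b,l,t,r)=(u_1,u_2,u_3,u_4)$ is denoted by its number $1+8u_1+4u_2+2u_3+u_4\in\{1,\dots,16\}$. For $\mathcal{B}\subset\Sigma_{2\times2}(2)$ and $m,n\ge 2$, $\Sigma_{m\times n}(\mathcal{B})$ is the set of all $\mathcal{B}$-admissible patterns on the lattice $\mathbb{Z}_{m\times n}=\{(i,j):0\le i\le m-1,\,0\le j\le n-1\}$, i.e. all arrays $(T_{i,j})_{0\le i\le m-2,\,0\le j\le n-2}$ of tiles of $\mathcal{B}$ with $r(T_{i,j})=l(T_{i+1,j})$ and $t(T_{i,j})=b(T_{i,j+1})$ whenever both tiles are in the array (tiles may not be rotated or reflected). Let $\Gamma_{m\times n}(\mathcal{B})=|\Sigma_{m\times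 n}(\mathcal{B})|$. The spatial entropy is $h(\mathcal{B})=\lim_{m,n\to\infty}\frac{\log\Gamma_{m\times n}(\mathcal{B})}{mn}$, with the convention $h(\mathcal{B})=0$ if $\Gamma_{m\times n}(\mathcal{B})=0$ for some $m,n$. $\mathcal{B}$ is marginal positive-entropy (MPE) if $h(\mathcal{B})>0$ and $h(\mathcal{B}')=0$ for every $\mathcal{B}'\subsetneq\mathcal{B}$. $\mathcal{B}$ is saturated zero-entropy (SZE) if $h(\mathcal{B})=0$ and $h(\mathcal{B}')>0$ for every $\mathcal{B}'\subset\Sigma_{2\times2}(2)$ with $\mathcal{B}'\supsetneq\mathcal{B}$. Equivalence: the dihedral group $D_4$ of order 8 (symmetries of the unit square) acts on tiles by rotating/reflecting the colored square; a permutation $\eta_h\in S_2$ of $\{0,1\}$ acts by permuting the colors of horizontal (bottom and top) edges, and $\eta_v\in S_2$ by permuting the colors of vertical (left and right) edges. The equivalence class $[\mathcal{B}]$ is the set of all $\mathcal{B}'=(((\mathcal{B})_{\tau})_{\eta_h})_{\eta_v}$ with $\tau\in D_4$, $\eta_h,\eta_v\in S_2$. The entropy $h$ is constant on each equivalence class. *)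

theory Defs
  imports Complex_Main "HOL-Library.FuncSet"
begin

text \<open>The colors 0 and 1 are the Booleans False and True, so that the type of all Wang tiles
  is the 16-element set of all tiles with two symbols.\<close>

datatype wang_tile =
  Wang_Tile (bottom_color: bool) (left_color: bool) (top_color: bool) (right_color: bool)

definition tile_number :: "wang_tile \<Rightarrow> nat" where
  "tile_number T = 1 + 8 * of_bool (bottom_color T) + 4 * of_bool (left_color T)
     + 2 * of_bool (top_color T) + of_bool (right_color T)"

definition tiles :: "nat set \<Rightarrow> wang_tile set" where
  "tiles N = {T. tile_number T \<in> N}"

text \<open>The lattice has \<open>m \<times> n\<close> vertices, hence \<open>(m - 1) \<times> (n - 1)\<close> cells. Only \<open>m, n \<ge> 2\<close> is
  meaningful. Arrays are extensional functions, so that the cardinality counts arrays.\<close>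

definition patterns :: "nat \<Rightarrow> nat \<Rightarrow> wang_tile set \<Rightarrow> (nat \<times> nat \<Rightarrow> wang_tile) set" where
  "patterns m n B = {T \<in> ({0..m-2} \<times> {0..n-2}) \<rightarrow>\<^sub>E B.
     (\<forall>i j. i + 1 \<le> m - 2 \<longrightarrow> j \<le> n - 2 \<longrightarrow> right_color (T (i, j)) = left_color (T (i + 1, j))) \<and>
     (\<forall>i j. i \<le> m - 2 \<longrightarrow> j + 1 \<le> n - 2 \<longrightarrow> top_color (T (i, j)) = bottom_color (T (i, j + 1)))}"

definition pattern_count :: "nat \<Rightarrow> nat \<Rightarrow> wang_tile set \<Rightarrow> nat" where
  "pattern_count m n B = card (patterns m n B)"

text \<open>The limit is the double limit, \<open>m\<close> and \<open>n\<close> tending to infinity independently; it exists by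
  subadditivity.\<close>

definition entropy :: "wang_tile set \<Rightarrow> real" where
  "entropy B =
     (if \<exists>m\<ge>2. \<exists>n\<ge>2. pattern_count m n B = 0 then 0
      else Lim (sequentially \<times>\<^sub>F sequentially)
             (\<lambda>(m, n). ln (real (pattern_count m n B)) / (real m * real n)))"

definition marginal_positive_entropy :: "wang_tile set \<Rightarrow> bool" where
  "marginal_positive_entropy B \<longleftrightarrow> entropy B > 0 \<and> (\<forall>B'. B' \<subset> B \<longrightarrow> entropy B' = 0)"

definition saturated_zero_entropy :: "wang_tile set \<Rightarrow> bool" where
  "saturated_zero_entropy B \<longleftrightarrow> entropy B = 0 \<and> (\<forall>B'. B \<subset> B' \<longrightarrow> entropy B' > 0)"

text \<open>Counterclockwise rotation by a right angle: the bottom edge becomes the right edge.\<close>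

definition rotate_tile :: "wang_tile \<Rightarrow> wang_tile" where
  "rotate_tile T =
     Wang_Tile (left_color T) (top_color T) (right_color T) (bottom_color T)"

text \<open>Reflection in the vertical axis.\<close>

definition reflect_tile :: "wang_tile \<Rightarrow> wang_tile" where
  "reflect_tile T =
     Wang_Tile (bottom_color T) (right_color T) (top_color T) (left_color T)"

definition dihedral4 :: "(wang_tile \<Rightarrow> wang_tile) set" where
  "dihedral4 = {reflect_tile ^^ i \<circ> rotate_tile ^^ k | i k. i < 2 \<and> k < 4}"

definition recolor_horizontal :: "(bool \<Rightarrow> bool) \<Rightarrow> wang_tile \<Rightarrow> wang_tile" where
  "recolor_horizontal \<eta> T =
     Wang_Tile (\<eta> (bottom_color T)) (left_color T) (\<eta> (top_color T)) (right_color T)"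

definition recolor_vertical :: "(bool \<Rightarrow> bool) \<Rightarrow> wang_tile \<Rightarrow> wang_tile" where
  "recolor_vertical \<eta> T =
     Wang_Tile (bottom_color T) (\<eta> (left_color T)) (top_color T) (\<eta> (right_color T))"

definition tile_class :: "wang_tile set \<Rightarrow> wang_tile set set" where
  "tile_class B = {recolor_vertical \<eta>v ` recolor_horizontal \<eta>h ` \<tau> ` B | \<tau> \<eta>h \<eta>v.
     \<tau> \<in> dihedral4 \<and> bij \<eta>h \<and> bij \<eta>v}"

end

theory Submission
  imports Defs
begin

text \<open>
  By subadditivity the double limit defining the entropy is an infimum, so the entropy is positive iff
  the number of arrays grows at least like \<open>exp (\<delta> M N)\<close>. This growth property is monotone in the tile
  set and invariant under the symmetries.

  Each of the 39 sets admits two different rectangular arrays that tile the plane periodically and can be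
  exchanged for one another in every cell of the period lattice, independently; this gives positive entropy.

  For the 18 sets, an \<open>N \<times> N\<close> array is determined by its tiles on a set of only \<open>O(N)\<close> cells, which gives
  entropy zero: after a symmetry, every set but \<open>{1,4,5,14}\<close> has a weight
  \<open>\<alpha>(t - b) + \<beta>(r - l) \<ge> 0\<close>, whose sum over an array telescopes to \<open>O(N)\<close>, and a tile of weight zero is
  determined by its bottom and left colors. For \<open>{1,4,5,14}\<close> the occurrences of tile 4 propagate along
  antidiagonals.

  Every set of tiles contains an equivalent of one of the 39 sets or is contained in an equivalent of one
  of the 18 sets, so the two lists determine the sign of the entropy of all \<open>2\<^sup>16\<close> sets.
\<close>

section \<open>Growth of the number of arrays\<close>

text \<open>Sizes count cells instead of vertices, so they add up when arrays are put side by side.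
  A side of length 0 is meaningful and leaves exactly the empty array.\<close>

definition arrays :: "nat \<Rightarrow> nat \<Rightarrow> wang_tile set \<Rightarrow> (nat \<times> nat \<Rightarrow> wang_tile) set" where
  "arrays M N B = {T \<in> ({..<M} \<times> {..<N}) \<rightarrow>\<^sub>E B.
     (\<forall>i j. i + 1 < M \<longrightarrow> j < N \<longrightarrow> right_color (T (i, j)) = left_color (T (i + 1, j))) \<and>
     (\<forall>i j. i < M \<longrightarrow> j + 1 < N \<longrightarrow> top_color (T (i, j)) = bottom_color (T (i, j + 1)))}"

abbreviation array_count :: "nat \<Rightarrow> nat \<Rightarrow> wang_tile set \<Rightarrow> nat" where
  "array_count M N B \<equiv> card (arrays M N B)"

text \<open>A uniform lower bound free of limits, which is easy to transfer to supersets and to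
  images under the symmetries.\<close>

definition positive :: "wang_tile set \<Rightarrow> bool" where
  "positive B \<longleftrightarrow> (\<exists>\<delta>>0. \<forall>M N. exp (\<delta> * real M * real N) \<le> real (array_count M N B))"

lemma patterns_eq_arrays: "m \<ge> 2 \<Longrightarrow> n \<ge> 2 \<Longrightarrow> patterns m n B = arrays (m - 1) (n - 1) B"
proof -
  assume *: "m \<ge> 2" "n \<ge> 2"
  have a: "{0..k-2} = {..<k-1}" if "k \<ge> 2" for k :: nat using that by auto
  have b: "i \<le> k - 2 \<longleftrightarrow> i < k - 1" if "k \<ge> 2" for i k :: nat using that by auto
  show ?thesis
    unfolding patterns_def arrays_def a[OF *(1)] a[OF *(2)] b[OF *(1)] b[OF *(2)] ..
qed

lemma UNIV_wang_tile: "(UNIV :: wang_tile set) = (\<lambda>(b,l,t,r). Wang_Tile b l t r) ` UNIV"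
  by (auto simp: image_def) (metis wang_tile.exhaust)

lemma finite_wang_tile [simp]: "finite (A :: wang_tile set)"
  by (rule finite_subset[OF subset_UNIV]) (simp add: UNIV_wang_tile)

lemma finite_arrays [simp]: "finite (arrays M N B)"
  unfolding arrays_def by (rule finite_subset[OF _ finite_PiE[of "{..<M} \<times> {..<N}" "\<lambda>_. B"]]) auto

lemma arrays_mono: "B \<subseteq> B' \<Longrightarrow> arrays M N B \<subseteq> arrays M N B'"
  unfolding arrays_def by (auto dest: PiE_mono[THEN subsetD, rotated])

lemma arraysD:
  assumes "T \<in> arrays M N B"
  shows "\<And>i j. i < M \<Longrightarrow> j < N \<Longrightarrow> T (i, j) \<in> B"
    and "\<And>i j. i + 1 < M \<Longrightarrow> j < N \<Longrightarrow> right_color (T (i, j)) = left_color (T (i + 1, j))"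
    and "\<And>i j. i < M \<Longrightarrow> j + 1 < N \<Longrightarrow> top_color (T (i, j)) = bottom_color (T (i, j + 1))"
  using assms unfolding arrays_def by (auto simp: PiE_iff)

lemma restrict_in_arrays:
  assumes "\<And>i j. i < M \<Longrightarrow> j < N \<Longrightarrow> T (i, j) \<in> B"
    and "\<And>i j. i + 1 < M \<Longrightarrow> j < N \<Longrightarrow> right_color (T (i, j)) = left_color (T (i + 1, j))"
    and "\<And>i j. i < M \<Longrightarrow> j + 1 < N \<Longrightarrow> top_color (T (i, j)) = bottom_color (T (i, j + 1))"
  shows "restrict T ({..<M} \<times> {..<N}) \<in> arrays M N B"
  using assms unfolding arrays_def by auto

lemma arrays_ext:
  assumes "T \<in> arrays M N B" "T' \<in> arrays M N B"
    and "\<And>i j. i < M \<Longrightarrow> j < N \<Longrightarrow> T (i, j) = T' (i, j)"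
  shows "T = T'"
proof (rule PiE_ext)
  show "T \<in> ({..<M} \<times> {..<N}) \<rightarrow>\<^sub>E B" "T' \<in> ({..<M} \<times> {..<N}) \<rightarrow>\<^sub>E B"
    using assms(1,2) unfolding arrays_def by auto
qed (use assms(3) in auto)

text \<open>Cutting along a vertical line loses no information: both pieces are admissible and
  together determine the array.\<close>

lemma array_count_add: "array_count (M1 + M2) N B \<le> array_count M1 N B * array_count M2 N B"
proof -
  define f where "f T = (restrict T ({..<M1} \<times> {..<N}),
    restrict (\<lambda>(i, j). T (i + M1, j)) ({..<M2} \<times> {..<N}))" for T :: "nat \<times> nat \<Rightarrow> wang_tile"
  have "inj_on f (arrays (M1 + M2) N B)"
  proof (rule inj_onI)
    fix T T' assume T: "T \<in> arrays (M1 + M2) N B" "T' \<in> arrays (M1 + M2) N B" and eq: "f T = f T'"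
    show "T = T'"
    proof (rule arrays_ext[OF T])
      fix i j assume ij: "i < M1 + M2" "j < N"
      show "T (i, j) = T' (i, j)"
      proof (cases "i < M1")
        case True
        then show ?thesis using arg_cong[OF eq, of "\<lambda>x. fst x (i, j)"] ij by (simp add: f_def)
      next
        case False
        then show ?thesis
          using arg_cong[OF eq, of "\<lambda>x. snd x (i - M1, j)"] ij by (auto simp: f_def split: if_splits)
      qed
    qed
  qed
  moreover have "f ` arrays (M1 + M2) N B \<subseteq> arrays M1 N B \<times> arrays M2 N B"
  proof (intro image_subsetI)
    fix T assume T: "T \<in> arrays (M1 + M2) N B"
    show "f T \<in> arrays M1 N B \<times> arrays M2 N B"
      unfolding f_def
    proof (intro SigmaI restrict_in_arrays)
      fix i j assume "i + 1 < M2" "j < N"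
      then show "right_color (case (i, j) of (i, j) \<Rightarrow> T (i + M1, j))
          = left_color (case (i + 1, j) of (i, j) \<Rightarrow> T (i + M1, j))"
        using arraysD(2)[OF T, of "i + M1" j] by simp
    qed (use arraysD[OF T] in auto)
  qed
  ultimately have "card (arrays (M1 + M2) N B) \<le> card (arrays M1 N B \<times> arrays M2 N B)"
    by (intro card_inj_on_le) auto
  then show ?thesis by (simp add: card_cartesian_product)
qed

section \<open>Transport of arrays along symmetries\<close>

text \<open>A common frame for all symmetries: \<open>\<sigma>\<close> moves the cells and
  \<open>f\<close> acts on the tiles. As \<open>f\<close> is injective and \<open>\<sigma>\<close>
  reaches every cell, distinct arrays have distinct images.\<close>

lemma array_count_transport:
  assumes "inj f" and \<sigma>: "{..<M} \<times> {..<N} \<subseteq> \<sigma> ` ({..<M'} \<times> {..<N'})"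
    and mem: "\<And>T. T \<in> arrays M N B \<Longrightarrow>
      restrict (\<lambda>p. f (T (\<sigma> p))) ({..<M'} \<times> {..<N'}) \<in> arrays M' N' (f ` B)"
  shows "array_count M N B \<le> array_count M' N' (f ` B)"
proof (rule card_inj_on_le)
  let ?g = "\<lambda>T. restrict (\<lambda>p. f (T (\<sigma> p))) ({..<M'} \<times> {..<N'})"
  show "inj_on ?g (arrays M N B)"
  proof (rule inj_onI)
    fix T T' assume T: "T \<in> arrays M N B" "T' \<in> arrays M N B" and eq: "?g T = ?g T'"
    show "T = T'"
    proof (rule arrays_ext[OF T])
      fix i j assume "i < M" "j < N"
      then have "(i, j) \<in> \<sigma> ` ({..<M'} \<times> {..<N'})" using \<sigma> by auto
      then obtain p where p: "p \<in> {..<M'} \<times> {..<N'}" "(i, j) = \<sigma> p" by blast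
      then show "T (i, j) = T' (i, j)" using fun_cong[OF eq, of p] \<open>inj f\<close> by (simp add: inj_eq)
    qed
  qed
qed (use mem in auto)

text \<open>Reflection in the diagonal. It exchanges the two coordinates, so that bounds in the
  first size carry over to the second, and a rotation is a reflection after a transposition.\<close>

definition transpose_tile :: "wang_tile \<Rightarrow> wang_tile" where
  "transpose_tile T = Wang_Tile (left_color T) (bottom_color T) (right_color T) (top_color T)"

lemma tile_colors [simp]:
  "bottom_color (transpose_tile T) = left_color T" "left_color (transpose_tile T) = bottom_color T"
  "top_color (transpose_tile T) = right_color T" "right_color (transpose_tile T) = top_color T"
  "bottom_color (reflect_tile T) = bottom_color T" "left_color (reflect_tile T) = right_color T"
  "top_color (reflect_tile T) = top_color T" "right_color (reflect_tile T) = left_color T"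
  "bottom_color (rotate_tile T) = left_color T" "left_color (rotate_tile T) = top_color T"
  "top_color (rotate_tile T) = right_color T" "right_color (rotate_tile T) = bottom_color T"
  "bottom_color (recolor_horizontal \<eta> T) = \<eta> (bottom_color T)"
  "left_color (recolor_horizontal \<eta> T) = left_color T"
  "top_color (recolor_horizontal \<eta> T) = \<eta> (top_color T)"
  "right_color (recolor_horizontal \<eta> T) = right_color T"
  "bottom_color (recolor_vertical \<eta> T) = bottom_color T"
  "left_color (recolor_vertical \<eta> T) = \<eta> (left_color T)"
  "top_color (recolor_vertical \<eta> T) = top_color T"
  "right_color (recolor_vertical \<eta> T) = \<eta> (right_color T)"
  unfolding transpose_tile_def reflect_tile_def rotate_tile_def recolor_horizontal_def
    recolor_vertical_def by simp_all

lemma bij_bool: "bij \<eta> \<longleftrightarrow> \<eta> = id \<or> \<eta> = Not" for \<eta> :: "bool \<Rightarrow> bool"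
proof
  assume "bij \<eta>"
  then have "\<eta> True \<noteq> \<eta> False" using inj_eq[OF bij_is_inj, of \<eta> True False] by simp
  then have "(\<forall>x. \<eta> x = x) \<or> (\<forall>x. \<eta> x = (\<not> x))" by (metis (full_types))
  then show "\<eta> = id \<or> \<eta> = Not" by (auto simp: fun_eq_iff)
next
  have "bij Not" by (rule o_bij[of Not]) (auto simp: fun_eq_iff)
  then show "\<eta> = id \<or> \<eta> = Not \<Longrightarrow> bij \<eta>" by auto
qed

lemma inj_tile_maps:
  "inj transpose_tile" "inj reflect_tile"
  "bij \<eta> \<Longrightarrow> inj (recolor_horizontal \<eta>)" "bij \<eta> \<Longrightarrow> inj (recolor_vertical \<eta>)"
  unfolding transpose_tile_def reflect_tile_def recolor_horizontal_def recolor_vertical_def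
  by (auto intro!: injI wang_tile.expand simp: bij_bool)

lemma array_count_transpose: "array_count M N B \<le> array_count N M (transpose_tile ` B)"
proof (rule array_count_transport[where \<sigma> = prod.swap, OF inj_tile_maps(1)])
  fix T assume T: "T \<in> arrays M N B"
  show "restrict (\<lambda>p. transpose_tile (T (prod.swap p))) ({..<N} \<times> {..<M})
      \<in> arrays N M (transpose_tile ` B)"
    using arraysD[OF T] by (intro restrict_in_arrays) auto
qed (auto simp: image_iff)

lemma array_count_reflect: "array_count M N B \<le> array_count M N (reflect_tile ` B)"
proof (rule array_count_transport[where \<sigma> = "\<lambda>(i, j). (M - 1 - i, j)", OF inj_tile_maps(2)])
  show "{..<M} \<times> {..<N} \<subseteq> (\<lambda>(i, j). (M - 1 - i, j)) ` ({..<M} \<times> {..<N})"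
  proof clarify
    fix i j assume "i < M" "j < N"
    then show "(i, j) \<in> (\<lambda>(i, j). (M - 1 - i, j)) ` ({..<M} \<times> {..<N})"
      by (intro image_eqI[of _ _ "(M - 1 - i, j)"]) auto
  qed
  fix T assume T: "T \<in> arrays M N B"
  show "restrict (\<lambda>p. reflect_tile (T (case p of (i, j) \<Rightarrow> (M - 1 - i, j)))) ({..<M} \<times> {..<N})
      \<in> arrays M N (reflect_tile ` B)"
  proof (intro restrict_in_arrays)
    fix i j assume "i + 1 < M" "j < N"
    \<comment> \<open>The columns are read backwards, so column \<open>M - 1 - i\<close> is the
      right neighbor of column \<open>M - 1 - (i + 1)\<close>. The bound on \<open>i\<close> keeps
      the truncated subtraction exact.\<close>
    moreover from this have "M - 1 - i = M - 1 - (i + 1) + 1" by simp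
    ultimately show "right_color (reflect_tile (T (case (i, j) of (i, j) \<Rightarrow> (M - 1 - i, j))))
        = left_color (reflect_tile (T (case (i + 1, j) of (i, j) \<Rightarrow> (M - 1 - i, j))))"
      using arraysD(2)[OF T, of "M - 1 - (i + 1)" j] by simp
  qed (use arraysD[OF T] in auto)
qed

lemma array_count_recolor:
  assumes "bij \<eta>"
  shows "array_count M N B \<le> array_count M N (recolor_horizontal \<eta> ` B)"
    and "array_count M N B \<le> array_count M N (recolor_vertical \<eta> ` B)"
proof -
  show "array_count M N B \<le> array_count M N (recolor_horizontal \<eta> ` B)"
    by (rule array_count_transport[where \<sigma> = id, OF inj_tile_maps(3)[OF assms]])
      (auto intro!: restrict_in_arrays dest: arraysD)
  show "array_count M N B \<le> array_count M N (recolor_vertical \<eta> ` B)"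
    by (rule array_count_transport[where \<sigma> = id, OF inj_tile_maps(4)[OF assms]])
      (auto intro!: restrict_in_arrays dest: arraysD)
qed

lemma transpose_transpose: "transpose_tile ` transpose_tile ` B = B"
  by (simp add: image_image transpose_tile_def)

lemma array_count_transpose_eq: "array_count N M (transpose_tile ` B) = array_count M N B"
  using array_count_transpose[of M N B] array_count_transpose[of N M "transpose_tile ` B"]
  by (simp add: transpose_transpose)

lemma array_count_add2: "array_count M (N1 + N2) B \<le> array_count M N1 B * array_count M N2 B"
  using array_count_add[of N1 N2 M "transpose_tile ` B"] by (simp add: array_count_transpose_eq)

lemma array_count_mult: "array_count (k * M) N B \<le> array_count M N B ^ k"
proof (induction k)
  case 0
  \<comment> \<open>For \<open>k = 0\<close> the bound is 1, and the array without columns is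
    unique.\<close>
  have "arrays 0 N B \<subseteq> {\<lambda>x. undefined}" unfolding arrays_def by auto
  then have "card (arrays 0 N B) \<le> card {\<lambda>x::nat \<times> nat. undefined :: wang_tile}"
    by (intro card_mono) auto
  then show ?case by simp
next
  case (Suc k)
  have "array_count (Suc k * M) N B \<le> array_count M N B * array_count (k * M) N B"
    using array_count_add[of M "k * M" N B] by simp
  then show ?case using Suc by (auto intro: order_trans mult_le_mono)
qed

lemma array_count_mult2: "array_count M (k * N) B \<le> array_count M N B ^ k"
  using array_count_mult[of k N M "transpose_tile ` B"] by (simp add: array_count_transpose_eq)

lemma array_count_mono: "B \<subseteq> B' \<Longrightarrow> array_count M N B \<le> array_count M N B'"
  by (intro card_mono arrays_mono) auto

lemma positiveI:
  assumes "\<delta> > 0" "\<And>M N. M \<ge> 1 \<Longrightarrow> N \<ge> 1 \<Longrightarrow> exp (\<delta> * real M * real N) \<le> real (array_count M N B)"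
  shows "positive B"
  unfolding positive_def
proof (intro exI[of _ \<delta>] conjI allI)
  fix M N :: nat
  show "exp (\<delta> * real M * real N) \<le> real (array_count M N B)"
  proof (cases "M \<ge> 1 \<and> N \<ge> 1")
    case False
    \<comment> \<open>With a side of length 0 the empty array exists for every \<open>B\<close>, and
      the required bound is \<open>exp 0 = 1\<close>.\<close>
    have "restrict undefined ({..<M} \<times> {..<N}) \<in> arrays M N B"
      using False by (intro restrict_in_arrays) auto
    then have "array_count M N B \<noteq> 0" by auto
    then show ?thesis using False by (auto simp: not_le)
  qed (use assms in auto)
qed (use assms in auto)

lemma positive_mono: "positive B \<Longrightarrow> B \<subseteq> B' \<Longrightarrow> positive B'"
  unfolding positive_def using array_count_mono of_nat_mono order_trans by meson

section \<open>Subadditive functions of two sizes\<close>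

text \<open>A two-dimensional Fekete lemma. The mismatch between \<open>m - 1\<close>,
  \<open>n - 1\<close> in the numerator and \<open>m\<close>, \<open>n\<close> in the denominator
  only contributes a factor tending to 1.\<close>

lemma subadditive_double_limit:
  fixes L :: "nat \<Rightarrow> nat \<Rightarrow> real"
  assumes nonneg: "\<And>M N. L M N \<ge> 0"
    and sub1: "\<And>M M' N. L (M + M') N \<le> L M N + L M' N"
    and sub2: "\<And>M N N'. L M (N + N') \<le> L M N + L M N'"
    and mult1: "\<And>k M N. L (k * M) N \<le> real k * L M N"
    and mult2: "\<And>k M N. L M (k * N) \<le> real k * L M N"
  defines "I \<equiv> INF (M, N) \<in> {1..} \<times> {1..}. L M N / (real M * real N)"
  shows "((\<lambda>(m, n). L (m - 1) (n - 1) / (real m * real n)) \<longlongrightarrow> I) (sequentially \<times>\<^sub>F sequentially)"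
proof (rule order_tendstoI)
  let ?F = "sequentially \<times>\<^sub>F sequentially :: (nat \<times> nat) filter"
  have bdd: "bdd_below ((\<lambda>(M, N). L M N / (real M * real N)) ` ({1..} \<times> {1..}))"
    by (rule bdd_belowI[of _ 0]) (auto simp: nonneg)
  have fst: "filterlim fst sequentially ?F" and snd: "filterlim snd sequentially ?F"
    unfolding filterlim_def by (rule filtermap_fst_prod_filter filtermap_snd_prod_filter)+
  have ev: "\<forall>\<^sub>F x in ?F. fst x \<ge> 2 \<and> snd x \<ge> 2"
    using fst snd unfolding filterlim_at_top by (simp add: eventually_conj)
  {
    fix a assume "a < I"
    \<comment> \<open>The infimum bounds the average per cell from below; passing from cells to
      vertices costs the two factors shown here.\<close>
    have "((\<lambda>x. I * ((1 - 1 / real (fst x)) * (1 - 1 / real (snd x)))) \<longlongrightarrow> I * ((1 - 0) * (1 - 0))) ?F"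
      by (intro tendsto_intros filterlim_compose[OF lim_1_over_n fst]
          filterlim_compose[OF lim_1_over_n snd])
    then have "\<forall>\<^sub>F x in ?F. a < I * ((1 - 1 / real (fst x)) * (1 - 1 / real (snd x)))"
      using \<open>a < I\<close> by (intro order_tendstoD) auto
    with ev show "\<forall>\<^sub>F x in ?F. a < (case x of (m, n) \<Rightarrow> L (m - 1) (n - 1) / (real m * real n))"
    proof eventually_elim
      case (elim x)
      obtain m n where x: "x = (Suc m, Suc n)" "m \<ge> 1" "n \<ge> 1"
        using elim by (cases x; cases "fst x"; cases "snd x") auto
      have "I \<le> L m n / (real m * real n)"
        unfolding I_def using x by (intro cINF_lower2[OF bdd, of "(m, n)"]) auto
      then have "I * (real m * real n) \<le> L m n" using x by (simp add: field_simps)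
      then have "I * (real m * real n) / (real (Suc m) * real (Suc n)) \<le> L m n / (real (Suc m) * real (Suc n))"
        by (intro divide_right_mono) auto
      moreover have "I * (real m * real n) / (real (Suc m) * real (Suc n))
         = I * ((1 - 1 / real (Suc m)) * (1 - 1 / real (Suc n)))"
        by (simp add: field_simps)
      ultimately show ?case using elim x by simp
    qed
  }
  {
    fix a assume "I < a"
    \<comment> \<open>A block whose average is already below \<open>a\<close>; larger rectangles are
      cut into copies of it.\<close>
    then obtain M0 N0 where MN: "M0 \<ge> 1" "N0 \<ge> 1" "L M0 N0 / (real M0 * real N0) < a"
      unfolding I_def by (subst (asm) cINF_less_iff[OF _ bdd]) auto
    define c where "c = L M0 N0 / (real M0 * real N0)"
    define K where "K = L 1 1"
    have K: "L M N \<le> real M * real N * K" for M N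
      using mult1[of M 1 N] mult2[of 1 N 1] mult_left_mono[of "L 1 N" "real N * K" "real M"]
      unfolding K_def by (simp add: mult.assoc)
    \<comment> \<open>Division with remainder by \<open>M0\<close> and \<open>N0\<close>: the full
      blocks cost \<open>c\<close> per cell, and the leftover strips, at most \<open>M0\<close> or
      \<open>N0\<close> wide, cost at most \<open>K\<close> per cell. The strips vanish after
      division by the area.\<close>
    have bound: "L M N \<le> c * (real M * real N) + real M * real N0 * K + real M0 * real N * K" for M N
    proof -
      have div: "real (k div k0) \<le> real k / real k0" "real (k mod k0) \<le> real k0" if "k0 \<ge> 1" for k k0 :: nat
        using that by (auto simp: of_nat_div_le_of_nat less_imp_le)
      have K0: "K \<ge> 0" unfolding K_def by (rule nonneg)
      have "L M0 N \<le> L M0 (N div N0 * N0) + L M0 (N mod N0)"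
        using sub2[of M0 "N div N0 * N0" "N mod N0"] by simp
      also have "\<dots> \<le> real (N div N0) * L M0 N0 + real M0 * real (N mod N0) * K"
        by (intro add_mono mult2 K)
      also have "\<dots> \<le> real N / real N0 * L M0 N0 + real M0 * real N0 * K"
        using div[OF MN(2)] nonneg K0 by (intro add_mono mult_mono mult_nonneg_nonneg) auto
      finally have 1: "L M0 N \<le> real N / real N0 * L M0 N0 + real M0 * real N0 * K" .
      have "L M N \<le> L (M div M0 * M0) N + L (M mod M0) N"
        using sub1[of "M div M0 * M0" "M mod M0" N] by simp
      also have "\<dots> \<le> real (M div M0) * L M0 N + real (M mod M0) * real N * K"
        by (intro add_mono mult1 K)
      also have "\<dots> \<le> real M / real M0 * L M0 N + real M0 * real N * K"
        using div[OF MN(1)] nonneg K0 by (intro add_mono mult_mono mult_nonneg_nonneg) auto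
      also have "\<dots> \<le> real M / real M0 * (real N / real N0 * L M0 N0 + real M0 * real N0 * K) + real M0 * real N * K"
        using 1 by (intro add_mono mult_left_mono) auto
      also have "\<dots> = c * (real M * real N) + real M * real N0 * K + real M0 * real N * K"
        unfolding c_def using MN by (simp add: field_simps)
      finally show ?thesis .
    qed
    have K0: "K \<ge> 0" and c0: "c \<ge> 0" unfolding K_def c_def by (simp_all add: nonneg)
    have "((\<lambda>x. c + real N0 * K * (1 / real (snd x)) + real M0 * K * (1 / real (fst x)))
        \<longlongrightarrow> c + real N0 * K * 0 + real M0 * K * 0) ?F"
      by (intro tendsto_intros filterlim_compose[OF lim_1_over_n fst]
          filterlim_compose[OF lim_1_over_n snd])
    then have "\<forall>\<^sub>F x in ?F. c + real N0 * K * (1 / real (snd x)) + real M0 * K * (1 / real (fst x)) < a"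
      using MN(3) by (intro order_tendstoD) (auto simp: c_def)
    with ev show "\<forall>\<^sub>F x in ?F. (case x of (m, n) \<Rightarrow> L (m - 1) (n - 1) / (real m * real n)) < a"
    proof eventually_elim
      case (elim x)
      obtain m n where x: "x = (m, n)" "m \<ge> 2" "n \<ge> 2" using elim by (cases x) auto
      have "L (m - 1) (n - 1) \<le> c * (real (m - 1) * real (n - 1)) + real (m - 1) * real N0 * K + real M0 * real (n - 1) * K"
        by (rule bound)
      also have "\<dots> \<le> c * (real m * real n) + real m * real N0 * K + real M0 * real n * K"
        using K0 c0 by (intro add_mono mult_mono mult_nonneg_nonneg) auto
      finally have "L (m - 1) (n - 1) / (real m * real n)
        \<le> (c * (real m * real n) + real m * real N0 * K + real M0 * real n * K) / (real m * real n)"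
        by (intro divide_right_mono) auto
      also have "\<dots> = c + real N0 * K * (1 / real n) + real M0 * K * (1 / real m)"
        using x by (simp add: field_simps)
      finally show ?case using elim x by simp
    qed
  }
qed

text \<open>The entropy is the infimum of the averages, so if positive it is itself an admissible
  \<open>\<delta>\<close>, and every admissible \<open>\<delta>\<close> lies below it. If some count
  vanishes, the entropy is 0 by convention and no exponential lower bound can hold.\<close>

lemma entropy_positive_iff: "entropy B > 0 \<longleftrightarrow> positive B"
  and entropy_nonneg: "entropy B \<ge> 0"
proof -
  have pc: "pattern_count m n B = array_count (m - 1) (n - 1) B" if "m \<ge> 2" "n \<ge> 2" for m n
    unfolding pattern_count_def using patterns_eq_arrays[OF that] by simp
  have "(entropy B > 0 \<longleftrightarrow> positive B) \<and> entropy B \<ge> 0"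
  proof (cases "\<exists>m\<ge>2. \<exists>n\<ge>2. pattern_count m n B = 0")
    case True
    then obtain m n where "m \<ge> 2" "n \<ge> 2" "array_count (m - 1) (n - 1) B = 0" using pc by metis
    then have "\<not> exp (\<delta> * real (m - 1) * real (n - 1)) \<le> real (array_count (m - 1) (n - 1) B)" for \<delta>
      by (metis exp_gt_zero not_less of_nat_0)
    then have "\<not> positive B" unfolding positive_def by blast
    then show ?thesis using True by (simp add: entropy_def)
  next
    case False
    \<comment> \<open>The case assumption speaks of sides of length at least 1; otherwise the empty
      array is there.\<close>
    have ne: "array_count M N B > 0" for M N
    proof (cases "M \<ge> 1 \<and> N \<ge> 1")
      case True
      then have "2 \<le> M + 1" "2 \<le> N + 1" by auto
      then have "array_count M N B \<noteq> 0" using False pc[of "M + 1" "N + 1"] by (metis add_diff_cancel_right')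
      then show ?thesis by blast
    next
      case False
      have "restrict undefined ({..<M} \<times> {..<N}) \<in> arrays M N B"
        using False by (intro restrict_in_arrays) auto
      then show ?thesis using card_gt_0_iff finite_arrays by blast
    qed
    define L where "L M N = ln (real (array_count M N B))" for M N
    define I where "I = (INF (M, N) \<in> {1..} \<times> {1..}. L M N / (real M * real N))"
    have L0: "L M N \<ge> 0" for M N unfolding L_def using ne[of M N] by simp
    have le_mult: "ln (real a) \<le> ln (real b) + ln (real c)"
      if "a \<le> b * c" "a > 0" "b > 0" "c > 0" for a b c :: nat
    proof -
      have "real a \<le> real b * real c" using that(1) by (metis of_nat_le_iff of_nat_mult)
      then have "ln (real a) \<le> ln (real b * real c)" using that by (subst ln_le_cancel_iff) auto
      then show ?thesis using that by (simp add: ln_mult)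
    qed
    have le_pow: "ln (real a) \<le> real k * ln (real b)" if "a \<le> b ^ k" "a > 0" "b > 0" for a b k :: nat
    proof -
      have "real a \<le> real b ^ k" using that(1) by (metis of_nat_le_iff of_nat_power)
      then have "ln (real a) \<le> ln (real b ^ k)" using that by (subst ln_le_cancel_iff) auto
      then show ?thesis using that by (simp add: ln_realpow)
    qed
    have "((\<lambda>(m, n). L (m - 1) (n - 1) / (real m * real n)) \<longlongrightarrow> I) (sequentially \<times>\<^sub>F sequentially)"
      unfolding I_def
      by (rule subadditive_double_limit[OF L0])
        (auto simp: L_def intro!: le_mult le_pow ne array_count_add array_count_add2
          array_count_mult array_count_mult2)
    moreover have "\<forall>\<^sub>F x in sequentially \<times>\<^sub>F sequentially.
       (case x of (m, n) \<Rightarrow> L (m - 1) (n - 1) / (real m * real n)) =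
       (case x of (m, n) \<Rightarrow> ln (real (pattern_count m n B)) / (real m * real n))"
      unfolding eventually_prod_sequentially by (intro exI[of _ 2]) (auto simp: L_def pc)
    ultimately have "((\<lambda>(m, n). ln (real (pattern_count m n B)) / (real m * real n)) \<longlongrightarrow> I)
        (sequentially \<times>\<^sub>F sequentially)"
      by (rule Lim_transform_eventually)
    then have "Lim (sequentially \<times>\<^sub>F sequentially)
         (\<lambda>(m, n). ln (real (pattern_count m n B)) / (real m * real n)) = I"
      by (intro tendsto_Lim) (simp_all add: prod_filter_eq_bot)
    then have ent: "entropy B = I" unfolding entropy_def if_not_P[OF False] .
    have bdd: "bdd_below ((\<lambda>(M, N). L M N / (real M * real N)) ` ({1..} \<times> {1..}))"
      by (rule bdd_belowI[of _ 0]) (auto simp: L0)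
    have "I \<ge> 0" unfolding I_def by (rule cINF_greatest) (auto simp: L0)
    moreover have "positive B" if "I > 0"
    proof (rule positiveI[OF that])
      fix M N :: nat assume MN: "M \<ge> 1" "N \<ge> 1"
      have "I \<le> L M N / (real M * real N)"
        unfolding I_def using MN by (intro cINF_lower2[OF bdd, of "(M, N)"]) auto
      then have "I * real M * real N \<le> L M N" using MN by (simp add: field_simps)
      then have "exp (I * real M * real N) \<le> exp (L M N)" by simp
      then show "exp (I * real M * real N) \<le> real (array_count M N B)"
        unfolding L_def using ne[of M N] by simp
    qed
    moreover have "I > 0" if pos: "positive B"
    proof -
      obtain \<delta> where d: "\<delta> > 0" "\<And>M N. exp (\<delta> * real M * real N) \<le> real (array_count M N B)"
        using pos unfolding positive_def by blast
      have "\<delta> \<le> L M N / (real M * real N)" if "M \<ge> 1" "N \<ge> 1" for M N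
      proof -
        have "ln (exp (\<delta> * real M * real N)) \<le> L M N"
          unfolding L_def using d(2)[of M N] ne[of M N] by (subst ln_le_cancel_iff) auto
        then show ?thesis using that by (simp add: field_simps)
      qed
      then have "\<delta> \<le> I" unfolding I_def by (intro cINF_greatest) auto
      then show ?thesis using d by simp
    qed
    ultimately show ?thesis using ent by auto
  qed
  then show "entropy B > 0 \<longleftrightarrow> positive B" "entropy B \<ge> 0" by auto
qed

section \<open>Sets of zero entropy\<close>

text \<open>A set of at most \<open>k\<close> elements is spelled as a word of length exactly
  \<open>k\<close>, with \<open>None\<close> as the padding letter.\<close>

lemma card_small_subsets_le:
  assumes "finite S"
  shows "card {A. A \<subseteq> S \<and> card A \<le> k} \<le> (card S + 1) ^ k"
proof -
  let ?X = "{xs. set xs \<subseteq> insert None (Some ` S) \<and> length xs = k}"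
  have "{A. A \<subseteq> S \<and> card A \<le> k} \<subseteq> (\<lambda>xs. {x. Some x \<in> set xs}) ` ?X"
  proof clarify
    fix A assume A: "A \<subseteq> S" "card A \<le> k"
    then obtain ys where ys: "set ys = A" "distinct ys"
      using finite_distinct_list finite_subset[OF _ assms] by blast
    then have "length ys \<le> k" using A distinct_card by metis
    then have "map Some ys @ replicate (k - length ys) None \<in> ?X" using ys A by auto
    moreover have "A = {x. Some x \<in> set (map Some ys @ replicate (k - length ys) None)}"
      using ys by auto
    ultimately show "A \<in> (\<lambda>xs. {x. Some x \<in> set xs}) ` ?X" by blast
  qed
  moreover have fin: "finite ?X" using assms by (intro finite_lists_length_eq) auto
  ultimately have "card {A. A \<subseteq> S \<and> card A \<le> k} \<le> card ?X"
    by (intro surj_card_le)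
  also have "\<dots> = (card S + 1) ^ k"
    using assms by (subst card_lists_length_eq) (auto simp: card_image)
  finally show ?thesis .
qed

text \<open>An array is encoded by the graph of its restriction to \<open>D\<close>, one of at most \<open>(16 N\<^sup>2 + 1)\<close> to the
  power \<open>C N\<close> sets, and this is subexponential in \<open>N\<^sup>2\<close>.\<close>

lemma not_positive_if_sparsely_determined:
  fixes C :: nat
  assumes D: "\<And>N T. N \<ge> 1 \<Longrightarrow> T \<in> arrays N N B \<Longrightarrow> D N T \<subseteq> {..<N} \<times> {..<N} \<and> card (D N T) \<le> C * N"
    and determined: "\<And>N T T'. N \<ge> 1 \<Longrightarrow> T \<in> arrays N N B \<Longrightarrow> T' \<in> arrays N N B \<Longrightarrow> D N T' = D N T \<Longrightarrow>
      (\<And>p. p \<in> D N T \<Longrightarrow> T p = T' p) \<Longrightarrow> T = T'"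
  shows "\<not> positive B"
proof
  assume "positive B"
  then obtain \<delta> where d: "\<delta> > 0" "\<And>M N. exp (\<delta> * real M * real N) \<le> real (array_count M N B)"
    unfolding positive_def by blast
  define a where "a = real (card (UNIV :: wang_tile set))"
  have bound: "\<delta> * real N \<le> real C * (ln (a + 1) + 2 * ln (real N))" if N: "N \<ge> 1" for N
  proof -
    define S where "S = ({..<N} \<times> {..<N}) \<times> (UNIV :: wang_tile set)"
    define code where "code T = (\<lambda>p. (p, T p)) ` D N T" for T
    \<comment> \<open>The code reveals \<open>D N T\<close> itself, so the determining cells may
      vary with the array.\<close>
    have dom: "fst ` code T = D N T" for T unfolding code_def by force
    have "inj_on code (arrays N N B)"
    proof (rule inj_onI)
      fix T T' assume T: "T \<in> arrays N N B" "T' \<in> arrays N N B" and eq: "code T = code T'"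
      have "D N T' = D N T" using eq dom by metis
      moreover have "T p = T' p" if "p \<in> D N T" for p
      proof -
        have "(p, T p) \<in> code T'" using that eq[symmetric] unfolding code_def by blast
        then show ?thesis unfolding code_def by auto
      qed
      ultimately show "T = T'" using determined[OF N T] by blast
    qed
    moreover have "code ` arrays N N B \<subseteq> {A. A \<subseteq> S \<and> card A \<le> C * N}"
    proof clarify
      fix T assume T: "T \<in> arrays N N B"
      have fin: "finite (D N T)" using D[OF N T] finite_subset by blast
      have "card (code T) \<le> card (D N T)" unfolding code_def by (rule card_image_le[OF fin])
      then show "code T \<subseteq> S \<and> card (code T) \<le> C * N"
        using D[OF N T] unfolding S_def code_def by auto
    qed
    moreover have "finite S" unfolding S_def by simp
    ultimately have "array_count N N B \<le> card {A. A \<subseteq> S \<and> card A \<le> C * N}"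
      by (intro card_inj_on_le) auto
    also have "\<dots> \<le> (card S + 1) ^ (C * N)" by (rule card_small_subsets_le) fact
    finally have "real (array_count N N B) \<le> real ((card S + 1) ^ (C * N))" by (rule of_nat_mono)
    also have "\<dots> = real (card S + 1) ^ (C * N)" by (rule of_nat_power)
    also have "real (card S + 1) = a * real N ^ 2 + 1"
      unfolding S_def a_def by (simp add: card_cartesian_product power2_eq_square)
    finally have le: "exp (\<delta> * real N * real N) \<le> (a * real N ^ 2 + 1) ^ (C * N)"
      using d(2)[of N N] by linarith
    have a: "a \<ge> 0" and pos: "a * real N ^ 2 + 1 > 0" unfolding a_def by (simp_all add: add_nonneg_pos)
    have "ln (a * real N ^ 2 + 1) \<le> ln ((a + 1) * real N ^ 2)"
    proof (subst ln_le_cancel_iff)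
      have "1 \<le> real N ^ 2" using N by simp
      then show "a * real N ^ 2 + 1 \<le> (a + 1) * real N ^ 2" by (simp add: algebra_simps)
      show "0 < (a + 1) * real N ^ 2" using N a by (intro mult_pos_pos) auto
    qed (rule pos)
    also have "\<dots> = ln (a + 1) + 2 * ln (real N)" using N a by (simp add: ln_mult ln_realpow)
    finally have ln_le: "ln (a * real N ^ 2 + 1) \<le> ln (a + 1) + 2 * ln (real N)" .
    have "\<delta> * real N * real N \<le> ln ((a * real N ^ 2 + 1) ^ (C * N))"
      using le pos by (subst ln_ge_iff) auto
    also have "\<dots> = real C * ln (a * real N ^ 2 + 1) * real N"
      using pos by (simp add: ln_realpow)
    finally have "\<delta> * real N \<le> real C * ln (a * real N ^ 2 + 1)"
      using N by (subst (asm) mult_le_cancel_right) auto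
    then show ?thesis using mult_left_mono[OF ln_le, of "real C"] by simp
  qed
  \<comment> \<open>Dividing \<open>bound\<close> by \<open>N\<close> leaves a right-hand side that
    tends to 0, against the fixed \<open>\<delta> > 0\<close>.\<close>
  have "(\<lambda>N. real C * (ln (a + 1) * (1 / real N) + 2 * (ln (real N) / real N)))
      \<longlonglongrightarrow> real C * (ln (a + 1) * 0 + 2 * 0)"
    by (intro tendsto_intros lim_1_over_n filterlim_compose[OF ln_x_over_x_tendsto_0]
        filterlim_real_sequentially)
  then have "\<forall>\<^sub>F N in sequentially. real C * (ln (a + 1) * (1 / real N) + 2 * (ln (real N) / real N)) < \<delta>"
    using d by (intro order_tendstoD) auto
  then have "\<forall>\<^sub>F N in sequentially. real C * (ln (a + 1) * (1 / real N) + 2 * (ln (real N) / real N)) < \<delta> \<and> N \<ge> 1"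
    by (intro eventually_conj eventually_ge_at_top)
  then obtain N where N: "N \<ge> 1" "real C * (ln (a + 1) * (1 / real N) + 2 * (ln (real N) / real N)) < \<delta>"
    using eventually_happens'[OF sequentially_bot] by blast
  from N(2) have "real C * (ln (a + 1) + 2 * ln (real N)) < \<delta> * real N"
    using N(1) by (simp add: field_simps)
  then show False using bound[OF N(1)] by simp
qed

section \<open>Sets with a nonnegative weight\<close>

definition tile_weight :: "int \<Rightarrow> int \<Rightarrow> wang_tile \<Rightarrow> int" where
  "tile_weight \<alpha> \<beta> T = \<alpha> * (of_bool (top_color T) - of_bool (bottom_color T))
     + \<beta> * (of_bool (right_color T) - of_bool (left_color T))"

text \<open>Neighbors share the color of their common edge, so a nonempty sum telescopes to a
  difference of two colors.\<close>

lemma sum_vertical_weight: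
  assumes "T \<in> arrays M N B" "i < M" "n \<le> N"
  shows "\<bar>\<Sum>j<n. of_bool (top_color (T (i, j))) - of_bool (bottom_color (T (i, j))) :: int\<bar> \<le> 1"
proof -
  have tele: "(\<Sum>j<Suc n. of_bool (top_color (T (i, j))) - of_bool (bottom_color (T (i, j))) :: int)
     = of_bool (top_color (T (i, n))) - of_bool (bottom_color (T (i, 0)))" if "n < N" for n
    using that
  proof (induction n)
    case (Suc n)
    then show ?case using arraysD(3)[OF assms(1,2), of n] by simp
  qed simp
  show ?thesis
  proof (cases n)
    case (Suc k)
    then have "k < N" using assms(3) by simp
    then show ?thesis unfolding Suc by (subst tele) auto
  qed simp
qed

lemma sum_horizontal_weight:
  assumes "T \<in> arrays M N B" "j < N" "m \<le> M"
  shows "\<bar>\<Sum>i<m. of_bool (right_color (T (i, j))) - of_bool (left_color (T (i, j))) :: int\<bar> \<le> 1"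
proof -
  have tele: "(\<Sum>i<Suc m. of_bool (right_color (T (i, j))) - of_bool (left_color (T (i, j))) :: int)
     = of_bool (right_color (T (m, j))) - of_bool (left_color (T (0, j)))" if "m < M" for m
    using that
  proof (induction m)
    case (Suc m)
    then show ?case using arraysD(2)[OF assms(1) _ assms(2), of m] by simp
  qed simp
  show ?thesis
  proof (cases m)
    case (Suc k)
    then have "k < M" using assms(3) by simp
    then show ?thesis unfolding Suc by (subst tele) auto
  qed simp
qed

text \<open>Summing the vertical part column by column and the horizontal part row by row leaves one
  boundary difference per line, hence order \<open>N\<close> rather than
  \<open>N\<^sup>2\<close>.\<close>

lemma sum_tile_weight_le:
  assumes "T \<in> arrays N N B"
  shows "(\<Sum>(i, j)\<in>{..<N} \<times> {..<N}. tile_weight \<alpha> \<beta> (T (i, j))) \<le> (\<bar>\<alpha>\<bar> + \<bar>\<beta>\<bar>) * int N"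
proof -
  let ?v = "\<lambda>i j. of_bool (top_color (T (i, j))) - of_bool (bottom_color (T (i, j))) :: int"
  let ?h = "\<lambda>i j. of_bool (right_color (T (i, j))) - of_bool (left_color (T (i, j))) :: int"
  have mult: "c * s \<le> \<bar>c\<bar>" if "\<bar>s\<bar> \<le> 1" for c s :: int
    using that abs_ge_self[of "c * s"] mult_left_mono[of "\<bar>s\<bar>" 1 "\<bar>c\<bar>"] by (simp add: abs_mult)
  have "(\<Sum>(i, j)\<in>{..<N} \<times> {..<N}. tile_weight \<alpha> \<beta> (T (i, j)))
      = (\<Sum>i<N. \<Sum>j<N. \<alpha> * ?v i j + \<beta> * ?h i j)"
    unfolding tile_weight_def by (subst sum.cartesian_product) simp
  also have "\<dots> = (\<Sum>i<N. \<alpha> * (\<Sum>j<N. ?v i j)) + (\<Sum>i<N. \<Sum>j<N. \<beta> * ?h i j)"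
    by (simp add: sum.distrib sum_distrib_left)
  also have "(\<Sum>i<N. \<Sum>j<N. \<beta> * ?h i j) = (\<Sum>j<N. \<beta> * (\<Sum>i<N. ?h i j))"
    by (subst sum.swap) (simp add: sum_distrib_left)
  also have "(\<Sum>i<N. \<alpha> * (\<Sum>j<N. ?v i j)) + (\<Sum>j<N. \<beta> * (\<Sum>i<N. ?h i j))
      \<le> (\<Sum>i<N. \<bar>\<alpha>\<bar>) + (\<Sum>j<N. \<bar>\<beta>\<bar>)"
    using sum_vertical_weight[OF assms] sum_horizontal_weight[OF assms]
    by (intro add_mono sum_mono mult) auto
  also have "\<dots> = (\<bar>\<alpha>\<bar> + \<bar>\<beta>\<bar>) * int N" by (simp add: algebra_simps)
  finally show ?thesis .
qed

lemma card_line_le: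
  shows "card {p \<in> {..<M} \<times> {..<N}. fst p = c} \<le> N" "card {p \<in> {..<M} \<times> {..<N}. snd p = c} \<le> M"
proof -
  have "{p \<in> {..<M} \<times> {..<N}. fst p = c} \<subseteq> Pair c ` {..<N}" by auto
  then show "card {p \<in> {..<M} \<times> {..<N}. fst p = c} \<le> N"
    by (subst (2) card_lessThan[symmetric], intro surj_card_le) auto
  have "{p \<in> {..<M} \<times> {..<N}. snd p = c} \<subseteq> (\<lambda>i. (i, c)) ` {..<M}" by auto
  then show "card {p \<in> {..<M} \<times> {..<N}. snd p = c} \<le> M"
    by (subst (2) card_lessThan[symmetric], intro surj_card_le) auto
qed

text \<open>The determining cells are the left column, the bottom row and the cells of positive
  weight. Weights are integers, so each of the latter contributes at least 1 to a sum of order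
  \<open>N\<close>. Every other tile has weight 0 and is read off from its left and lower
  neighbors.\<close>

lemma not_positive_if_weight:
  assumes nonneg: "\<And>T. T \<in> B \<Longrightarrow> tile_weight \<alpha> \<beta> T \<ge> 0"
    and inj: "inj_on (\<lambda>T. (bottom_color T, left_color T)) {T \<in> B. tile_weight \<alpha> \<beta> T = 0}"
  shows "\<not> positive B"
proof (rule not_positive_if_sparsely_determined)
  define X where "X N T = {p \<in> {..<N} \<times> {..<N}. tile_weight \<alpha> \<beta> (T p) > 0}"
    for N and T :: "nat \<times> nat \<Rightarrow> wang_tile"
  define D where "D N T = {p \<in> {..<N} \<times> {..<N}. fst p = 0} \<union> {p \<in> {..<N} \<times> {..<N}. snd p = 0} \<union> X N T"
    for N :: nat and T :: "nat \<times> nat \<Rightarrow> wang_tile"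
  fix N :: nat and T assume T: "T \<in> arrays N N B"
  have mem: "T p \<in> B" if "p \<in> {..<N} \<times> {..<N}" for p using that arraysD(1)[OF T] by auto
  have "int (card (X N T)) = (\<Sum>p\<in>X N T. 1)" by simp
  also have "\<dots> \<le> (\<Sum>p\<in>X N T. tile_weight \<alpha> \<beta> (T p))" by (rule sum_mono) (simp add: X_def)
  also have "\<dots> \<le> (\<Sum>p\<in>{..<N} \<times> {..<N}. tile_weight \<alpha> \<beta> (T p))"
    by (rule sum_mono2) (use mem nonneg in \<open>auto simp: X_def\<close>)
  also have "\<dots> \<le> (\<bar>\<alpha>\<bar> + \<bar>\<beta>\<bar>) * int N" using sum_tile_weight_le[OF T] by (simp add: case_prod_unfold)
  finally have "int (card (X N T)) \<le> int (nat (\<bar>\<alpha>\<bar> + \<bar>\<beta>\<bar>) * N)" by simp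
  then have "card (X N T) \<le> nat (\<bar>\<alpha>\<bar> + \<bar>\<beta>\<bar>) * N" by linarith
  moreover have "card (D N T) \<le> card {p \<in> {..<N} \<times> {..<N}. fst p = 0} + card {p \<in> {..<N} \<times> {..<N}. snd p = 0} + card (X N T)"
    unfolding D_def by (intro order_trans[OF card_Un_le] add_mono card_Un_le order_refl)
  ultimately have "card (D N T) \<le> N + N + nat (\<bar>\<alpha>\<bar> + \<bar>\<beta>\<bar>) * N"
    using card_line_le[of N N 0] by linarith
  moreover have "D N T \<subseteq> {..<N} \<times> {..<N}" unfolding D_def X_def by auto
  ultimately show "D N T \<subseteq> {..<N} \<times> {..<N} \<and> card (D N T) \<le> (2 + nat (\<bar>\<alpha>\<bar> + \<bar>\<beta>\<bar>)) * N"
    by (simp add: algebra_simps)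
  fix T' assume T': "T' \<in> arrays N N B" and dom: "D N T' = D N T"
    and agree: "\<And>p. p \<in> D N T \<Longrightarrow> T p = T' p"
  \<comment> \<open>Induction over antidiagonals: the left and the lower neighbor lie on the
    preceding one.\<close>
  have "T (i, j) = T' (i, j)" if "i < N" "j < N" for i j
    using that
  proof (induction "i + j" arbitrary: i j rule: less_induct)
    case less
    show ?case
    proof (cases "(i, j) \<in> D N T")
      case False
      then have ij: "i \<noteq> 0" "j \<noteq> 0" using less.prems unfolding D_def by auto
      have zero: "tile_weight \<alpha> \<beta> (S (i, j)) = 0" "S (i, j) \<in> B"
        if "S \<in> arrays N N B" "(i, j) \<notin> D N S" for S
        using that less.prems nonneg[of "S (i, j)"] arraysD(1)[OF that(1)] unfolding D_def X_def by force+
      have nb: "left_color (S (i, j)) = right_color (S (i - 1, j))"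
           "bottom_color (S (i, j)) = top_color (S (i, j - 1))" if "S \<in> arrays N N B" for S
        using arraysD(2)[OF that, of "i - 1" j] arraysD(3)[OF that, of i "j - 1"] ij less.prems by auto
      have "T (i - 1, j) = T' (i - 1, j)" "T (i, j - 1) = T' (i, j - 1)"
        using less.hyps[of "i - 1" j] less.hyps[of i "j - 1"] ij less.prems by auto
      then show ?thesis
        using zero[OF T False] zero[OF T'] nb[OF T] nb[OF T'] dom False
        by (intro inj_onD[OF inj]) auto
    qed (rule agree)
  qed
  then show "T = T'" by (rule arrays_ext[OF T T'])
qed

text \<open>The set \<open>{1,4,5,14}\<close>, with \<open>X\<close> the tile 4.\<close>

context
  fixes B X
  assumes B: "B = {Wang_Tile False False False False, X, Wang_Tile False True False False,
      Wang_Tile True True False True}"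
    and X: "X = Wang_Tile False False True True"
begin

lemma diagonal_tiles:
  assumes "S \<in> B"
  shows "bottom_color S \<Longrightarrow> left_color S" "top_color S \<longleftrightarrow> S = X"
    "right_color S \<longleftrightarrow> S = X \<or> bottom_color S" "S = X \<Longrightarrow> \<not> left_color S"
  using assms unfolding B by (auto simp: X)

lemma diagonal_tile_eqI:
  assumes "S \<in> B" "S' \<in> B" "bottom_color S = bottom_color S'" "left_color S = left_color S'"
    "top_color S = top_color S'"
  shows "S = S'"
  using assms unfolding B by (elim insertE emptyE) (simp_all add: X)

text \<open>The top color 1 of \<open>X\<close> forces left color 1 on the tile above it, so the
  tile at \<open>(i, j + 1)\<close> has right color 1 and is \<open>X\<close> or tile 14. Tile 14
  would need an \<open>X\<close> at \<open>(i, j)\<close>, whose right color 1 clashes with the left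
  color 0 of the given \<open>X\<close>.\<close>

lemma diagonal_step:
  assumes T: "T \<in> arrays M N B" and "i + 1 < M" "j + 1 < N" "T (i + 1, j) = X"
  shows "T (i, j + 1) = X"
proof -
  have mem: "T (i, j) \<in> B" "T (i + 1, j) \<in> B" "T (i, j + 1) \<in> B" "T (i + 1, j + 1) \<in> B"
    using arraysD(1)[OF T] assms by auto
  have "left_color (T (i + 1, j + 1))"
    using arraysD(3)[OF T, of "i + 1" j] assms mem diagonal_tiles by metis
  then have "right_color (T (i, j + 1))" using arraysD(2)[OF T, of i "j + 1"] assms by simp
  moreover have "\<not> top_color (T (i, j))"
    using arraysD(2)[OF T, of i j] assms diagonal_tiles mem by (metis add_lessD1)
  ultimately show ?thesis
    using diagonal_tiles(3)[OF mem(3)] arraysD(3)[OF T, of i j] assms by simp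
qed

lemma diagonal_propagation:
  assumes T: "T \<in> arrays M N B" and "i < M" "j + k < N" "k \<le> i" "T (i, j) = X"
  shows "T (i - k, j + k) = X"
  using assms(3,4)
proof (induction k)
  case (Suc k)
  then show ?case using diagonal_step[OF T, of "i - Suc k" "j + k"] assms(2) by (simp add: Suc_diff_Suc)
qed (use assms in simp)

text \<open>By propagation the tiles \<open>X\<close> on an antidiagonal form a run reaching up to
  the border, so recording where each run begins fixes them all. Their positions give all top
  colors, and with the left column and the bottom row known the tiles follow column by
  column.\<close>

lemma not_positive_diagonal: "\<not> positive B"
proof (rule not_positive_if_sparsely_determined)
  \<comment> \<open>A pair \<open>(i, j)\<close> marks a run beginning at \<open>(i, j + 1)\<close>,
    which is the cell put into \<open>D\<close>. Cells of the last column and of the bottom row have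
    no lower right neighbor, so these lines belong to \<open>D\<close> as a whole.\<close>
  define E where "E N T = {(i, j). i + 1 < N \<and> j + 1 < N \<and> T (i, j + 1) = X \<and> T (i + 1, j) \<noteq> X}"
    for N :: nat and T :: "nat \<times> nat \<Rightarrow> wang_tile"
  define D where "D N T = {p \<in> {..<N} \<times> {..<N}. fst p = 0} \<union> {p \<in> {..<N} \<times> {..<N}. fst p = N - 1}
      \<union> {p \<in> {..<N} \<times> {..<N}. snd p = 0} \<union> apsnd Suc ` E N T"
    for N :: nat and T :: "nat \<times> nat \<Rightarrow> wang_tile"
  fix N :: nat and T assume N: "N \<ge> 1" and T: "T \<in> arrays N N B"
  \<comment> \<open>At most one run begins on each antidiagonal: the lower one would propagate to
    \<open>(i' + 1, j')\<close>, the cell just before the start of the other.\<close>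
  have notless: "\<not> j < j'" if E: "(i, j) \<in> E N T" "(i', j') \<in> E N T" and eq: "i + j = i' + j'" for i j i' j'
  proof
    assume "j < j'"
    then have "T (i - (j' - (j + 1)), (j + 1) + (j' - (j + 1))) = X"
      using E eq by (intro diagonal_propagation[OF T]) (auto simp: E_def)
    moreover have "i - (j' - (j + 1)) = i' + 1" "(j + 1) + (j' - (j + 1)) = j'"
      using \<open>j < j'\<close> eq by auto
    ultimately show False using E unfolding E_def by auto
  qed
  have "inj_on (\<lambda>(i, j). i + j) (E N T)"
  proof (rule inj_onI, clarify)
    fix i j i' j' assume *: "(i, j) \<in> E N T" "(i', j') \<in> E N T" "i + j = i' + j'"
    then have "j = j'" using notless[OF *] notless[OF *(2,1)] by simp
    then show "i = i' \<and> j = j'" using * by simp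
  qed
  moreover have "(\<lambda>(i, j). i + j) ` E N T \<subseteq> {..<2 * N}" unfolding E_def by auto
  ultimately have "card (E N T) \<le> card {..<2 * N}" by (intro card_inj_on_le) auto
  moreover have fin: "finite (E N T)"
    by (rule finite_subset[of _ "{..<N} \<times> {..<N}"]) (auto simp: E_def)
  ultimately have "card (apsnd Suc ` E N T) \<le> 2 * N"
    using card_image_le[OF fin, of "apsnd Suc"] by simp
  moreover have "card (D N T) \<le> card {p \<in> {..<N} \<times> {..<N}. fst p = 0} + card {p \<in> {..<N} \<times> {..<N}. fst p = N - 1}
      + card {p \<in> {..<N} \<times> {..<N}. snd p = 0} + card (apsnd Suc ` E N T)"
    unfolding D_def by (intro order_trans[OF card_Un_le] add_mono card_Un_le order_refl)
  ultimately have "card (D N T) \<le> 5 * N"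
    using card_line_le(1)[of N N 0] card_line_le(1)[of N N "N - 1"] card_line_le(2)[of N N 0] by linarith
  then show "D N T \<subseteq> {..<N} \<times> {..<N} \<and> card (D N T) \<le> 5 * N"
    unfolding D_def E_def by auto
  fix T' assume T': "T' \<in> arrays N N B" and dom: "D N T' = D N T"
    and agree: "\<And>p. p \<in> D N T \<Longrightarrow> T p = T' p"
  \<comment> \<open>An \<open>X\<close> outside \<open>D\<close> does not begin a run, so there is
    an \<open>X\<close> to its lower right; \<open>S'\<close> has that one too, and it propagates
    back. The lemma is applied with \<open>T\<close> and \<open>T'\<close> in both orders.\<close>
  have X_step: "S' (i, j) = X"
    if S: "S \<in> arrays N N B" "S' \<in> arrays N N B" "(i, j) \<notin> D N S" "i < N" "j < N" "S (i, j) = X"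
      and prev: "S (i + 1, j - 1) = X \<longrightarrow> S' (i + 1, j - 1) = X" for S S' i j
  proof -
    have ij: "i + 1 < N" "j > 0" using S(3-5) unfolding D_def by auto
    have "(i, j - 1) \<notin> E N S" using S(3) ij unfolding D_def by (force simp: image_iff)
    then have "S (i + 1, j - 1) = X" using ij S(5,6) unfolding E_def by auto
    then have "S' (i + 1, j - 1) = X" using prev by simp
    then show ?thesis using diagonal_step[OF S(2), of i "j - 1"] ij S(5) by simp
  qed
  have same_X: "T (i, j) = X \<longleftrightarrow> T' (i, j) = X" if "i < N" "j < N" for i j
    using that
  proof (induction j arbitrary: i)
    case 0
    then show ?case using agree[of "(i, 0)"] unfolding D_def by auto
  next
    case (Suc j)
    show ?case
    proof (cases "(i, Suc j) \<in> D N T")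
      case False
      then have "i + 1 < N" using Suc.prems unfolding D_def by auto
      then show ?thesis
        using Suc X_step[OF T T' False] X_step[OF T' T, of i "Suc j"] dom False by auto
    qed (simp add: agree)
  qed
  \<comment> \<open>Equal positions of \<open>X\<close> mean equal top colors, hence equal bottom
    colors one row higher; the left colors come from the preceding column.\<close>
  have "T (i, j) = T' (i, j)" if "i < N" "j < N" for i j
    using that
  proof (induction i)
    case 0
    then show ?case using agree[of "(0, j)"] unfolding D_def by auto
  next
    case (Suc i)
    show ?case
    proof (cases "j = 0")
      case True
      then show ?thesis using Suc.prems agree[of "(Suc i, j)"] unfolding D_def by auto
    next
      case False
      have mem: "T (Suc i, k) \<in> B" "T' (Suc i, k) \<in> B" if "k < N" for k
        using arraysD(1)[OF T] arraysD(1)[OF T'] Suc.prems that by auto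
      have top_eq: "top_color (T (Suc i, k)) = top_color (T' (Suc i, k))" if "k < N" for k
        using diagonal_tiles(2)[OF mem(1)[OF that]] diagonal_tiles(2)[OF mem(2)[OF that]] same_X[OF Suc.prems(1) that] by simp
      have "bottom_color (T (Suc i, j)) = bottom_color (T' (Suc i, j))"
        using top_eq[of "j - 1"] arraysD(3)[OF T Suc.prems(1), of "j - 1"]
          arraysD(3)[OF T' Suc.prems(1), of "j - 1"] False Suc.prems by simp
      moreover have "left_color (T (Suc i, j)) = left_color (T' (Suc i, j))"
        using Suc arraysD(2)[OF T, of i j] arraysD(2)[OF T', of i j] by simp
      ultimately show ?thesis
        using top_eq[OF Suc.prems(2)] mem[OF Suc.prems(2)] by (intro diagonal_tile_eqI)
    qed
  qed
  then show "T = T'" by (rule arrays_ext[OF T T'])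
qed

end

section \<open>Sets of positive entropy\<close>

text \<open>\<open>A True\<close> and \<open>A False\<close> are blocks of the same size, and the
  free \<open>s'\<close> says that either may follow either across a block boundary. Filling an
  \<open>a\<close> by \<open>b\<close> grid of blocks independently gives \<open>2 ^ (a * b)\<close>
  arrays. By subadditivity this is at most the power \<open>p * q\<close> of the count for size
  \<open>a\<close> by \<open>b\<close>, so the rate \<open>ln 2 / (p * q)\<close> holds at every
  size.\<close>

lemma positive_if_interchangeable_blocks:
  fixes A :: "bool \<Rightarrow> nat \<Rightarrow> nat \<Rightarrow> wang_tile"
  assumes mem: "\<And>s i j. i < p \<Longrightarrow> j < q \<Longrightarrow> A s i j \<in> B"
    and horiz: "\<And>s s' i j. i < p \<Longrightarrow> j < q \<Longrightarrow>
      right_color (A s i j) = left_color (A (if Suc i < p then s else s') (Suc i mod p) j)"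
    and vert: "\<And>s s' i j. i < p \<Longrightarrow> j < q \<Longrightarrow>
      top_color (A s i j) = bottom_color (A (if Suc j < q then s else s') i (Suc j mod q))"
    and differ: "i0 < p" "j0 < q" "A True i0 j0 \<noteq> A False i0 j0"
  shows "positive B"
proof (rule positiveI)
  show "ln 2 / (real p * real q) > 0" using differ by simp
  fix a b :: nat
  define S where "S = ({..<a} \<times> {..<b}) \<rightarrow>\<^sub>E (UNIV :: bool set)"
  define \<Phi> where "\<Phi> f = restrict (\<lambda>(x, y). A (f (x div p, y div q)) (x mod p) (y mod q))
      ({..<a * p} \<times> {..<b * q})" for f
  have divmod: "Suc x div k = (if Suc (x mod k) < k then x div k else Suc (x div k))"
    "Suc x mod k = Suc (x mod k) mod k" if "k > 0" for x k :: nat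
    using that using mod_less_divisor[OF that, of x] by (auto simp: div_Suc mod_Suc)
  have "inj_on \<Phi> S"
  proof (rule inj_onI)
    fix f g assume fg: "f \<in> S" "g \<in> S" and eq: "\<Phi> f = \<Phi> g"
    show "f = g"
    proof (rule PiE_ext)
      show "f \<in> ({..<a} \<times> {..<b}) \<rightarrow>\<^sub>E UNIV" "g \<in> ({..<a} \<times> {..<b}) \<rightarrow>\<^sub>E UNIV"
        using fg unfolding S_def by auto
      fix z assume "z \<in> {..<a} \<times> {..<b}"
      then obtain u v where z: "z = (u, v)" "u < a" "v < b" by auto
      \<comment> \<open>In the block at \<open>(u, v)\<close>, the cell \<open>(i0, j0)\<close>
        where the two blocks differ reveals the choice \<open>f (u, v)\<close>.\<close>
      have lt: "i0 + p * u < a * p" "j0 + q * v < b * q"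
        using less_mult_imp_div_less differ z by (auto simp: div_less_iff_less_mult[symmetric])
      have "A (f (u, v)) i0 j0 = A (g (u, v)) i0 j0"
        using fun_cong[OF eq, of "(i0 + p * u, j0 + q * v)"] lt differ by (simp add: \<Phi>_def)
      then show "f z = g z"
        using differ(3) z by (cases "f (u, v)"; cases "g (u, v)") auto
    qed
  qed
  moreover have "\<Phi> ` S \<subseteq> arrays (a * p) (b * q) B"
  proof (intro image_subsetI)
    fix f
    have pq: "p > 0" "q > 0" using differ by auto
    show "\<Phi> f \<in> arrays (a * p) (b * q) B"
      unfolding \<Phi>_def
    proof (rule restrict_in_arrays)
      fix i j assume "i + 1 < a * p" "j < b * q"
      have "right_color (A (f (i div p, j div q)) (i mod p) (j mod q))
        = left_color (A (if Suc (i mod p) < p then f (i div p, j div q) else f (Suc (i div p), j div q))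
            (Suc (i mod p) mod p) (j mod q))"
        by (rule horiz) (use pq in auto)
      then show "right_color (case (i, j) of (x, y) \<Rightarrow> A (f (x div p, y div q)) (x mod p) (y mod q))
        = left_color (case (i + 1, j) of (x, y) \<Rightarrow> A (f (x div p, y div q)) (x mod p) (y mod q))"
        using divmod[OF pq(1), of i] by (auto split: if_splits)
    next
      fix i j assume "i < a * p" "j + 1 < b * q"
      have "top_color (A (f (i div p, j div q)) (i mod p) (j mod q))
        = bottom_color (A (if Suc (j mod q) < q then f (i div p, j div q) else f (i div p, Suc (j div q)))
            (i mod p) (Suc (j mod q) mod q))"
        by (rule vert) (use pq in auto)
      then show "top_color (case (i, j) of (x, y) \<Rightarrow> A (f (x div p, y div q)) (x mod p) (y mod q))
        = bottom_color (case (i, j + 1) of (x, y) \<Rightarrow> A (f (x div p, y div q)) (x mod p) (y mod q))"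
        using divmod[OF pq(2), of j] by (auto split: if_splits)
    qed (use pq in \<open>auto intro: mem\<close>)
  qed
  ultimately have "card S \<le> array_count (a * p) (b * q) B" by (intro card_inj_on_le) auto
  also have "\<dots> \<le> array_count a (b * q) B ^ p"
    using array_count_mult[of p a] by (simp add: mult.commute)
  also have "\<dots> \<le> (array_count a b B ^ q) ^ p"
    using array_count_mult2[of a q b] by (intro power_mono) (simp_all add: mult.commute)
  finally have "2 ^ (a * b) \<le> array_count a b B ^ (p * q)"
    unfolding S_def by (simp add: card_PiE card_cartesian_product power_mult[symmetric] mult.commute)
  then have "real (2 ^ (a * b)) \<le> real (array_count a b B ^ (p * q))" by (rule of_nat_mono)
  then have "2 ^ (a * b) \<le> real (array_count a b B) ^ (p * q)" by simp
  moreover have "exp (ln 2 / (real p * real q) * real a * real b) ^ (p * q) = 2 ^ (a * b)"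
  proof -
    have "real (p * q) * (ln 2 / (real p * real q) * real a * real b) = real (a * b) * ln 2"
      using differ by simp
    then show ?thesis by (simp only: exp_of_nat_mult[symmetric]) (simp only: exp_of_nat_mult exp_ln)
  qed
  ultimately have "exp (ln 2 / (real p * real q) * real a * real b) ^ (p * q)
      \<le> real (array_count a b B) ^ (p * q)" by simp
  then show "exp (ln 2 / (real p * real q) * real a * real b) \<le> real (array_count a b B)"
    using differ by (subst (asm) power_mono_iff) auto
qed

section \<open>Periodic blocks as computable certificates\<close>

definition tile_of :: "nat \<Rightarrow> wang_tile" where
  "tile_of n = Wang_Tile (odd ((n - 1) div 8)) (odd ((n - 1) div 4)) (odd ((n - 1) div 2)) (odd (n - 1))"

lemma tile_of_tile_number [simp]: "tile_of (tile_number T) = T"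
  by (cases T) (auto simp: tile_of_def tile_number_def)

lemma tile_number_range: "tile_number T \<in> {1..16}"
  by (cases T) (auto simp: tile_number_def)

lemma tile_number_tile_of: "n \<in> {1..16} \<Longrightarrow> tile_number (tile_of n) = n"
proof -
  assume n: "n \<in> {1..16}"
  have "\<forall>n \<in> set [1..<17]. tile_number (tile_of n) = n" by code_simp
  then show ?thesis using n by auto
qed

lemma tiles_eq: "N \<subseteq> {1..16} \<Longrightarrow> tiles N = tile_of ` N"
proof -
  assume "N \<subseteq> {1..16}"
  then have "tile_number (tile_of n) = n" if "n \<in> N" for n using that tile_number_tile_of by blast
  then show ?thesis unfolding tiles_def by (force simp: image_iff)
qed

text \<open>Blocks are lists of rows, from bottom to top.\<close>

definition interchangeable :: "wang_tile list \<Rightarrow> wang_tile list list \<Rightarrow> wang_tile list list \<Rightarrow> bool" where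
  "interchangeable N R R' \<longleftrightarrow> R' \<noteq> R \<and> length R' = length R \<and> R \<noteq> [] \<and> hd R \<noteq> [] \<and>
     (\<forall>X\<in>set [R, R']. list_all (\<lambda>r. length r = length (hd R) \<and> list_all (\<lambda>T. T \<in> set N) r) X \<and>
       (\<forall>Y\<in>set [R, R'].
         map (map top_color) X = tl (map (map bottom_color) X) @ [map bottom_color (hd Y)] \<and>
         list_all2 (\<lambda>r r'. map right_color r = tl (map left_color r) @ [left_color (hd r')]) X Y))"

text \<open>The shifted list in \<open>interchangeable\<close> is a cyclic successor: its last entry
  is the first one of the neighboring block \<open>ys\<close>.\<close>

lemma map_tl_append_hd_nth:
  "i < length xs \<Longrightarrow> ys \<noteq> [] \<Longrightarrow> (tl (map f xs) @ [f (hd ys)]) ! i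
     = f ((if Suc i < length xs then xs else ys) ! (Suc i mod length xs))"
  by (cases "Suc i = length xs") (auto simp: nth_append nth_tl hd_conv_nth)

lemma positive_if_interchangeable:
  assumes "interchangeable N R R'"
  shows "positive (set N)"
proof -
  define p where "p = length (hd R)"
  define q where "q = length R"
  define X where "X s = (if s then R' else R)" for s
  define A where "A s i j = X s ! j ! i" for s i j
  have X: "X s \<in> set [R, R']" for s unfolding X_def by auto
  note int = assms[unfolded interchangeable_def, folded p_def]
  have len: "length (X s) = q" "\<And>j. j < q \<Longrightarrow> length (X s ! j) = p" for s
    using int X unfolding q_def X_def by (auto simp: list_all_length)
  have pq: "p > 0" "q > 0" using int unfolding p_def q_def by auto
  have ne: "X s \<noteq> []" "\<And>j. j < q \<Longrightarrow> X s ! j \<noteq> []" for s using len pq by force+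
  obtain i0 j0 where "i0 < p" "j0 < q" "A True i0 j0 \<noteq> A False i0 j0"
  proof -
    have "X True \<noteq> X False" using int unfolding X_def by simp
    then obtain j where j: "j < q" "X True ! j \<noteq> X False ! j"
      using len(1) by (metis nth_equalityI)
    then obtain i where "i < p" "X True ! j ! i \<noteq> X False ! j ! i"
      using len(2) by (metis nth_equalityI)
    then show ?thesis using that j unfolding A_def by blast
  qed
  moreover have "A s i j \<in> set N" if "i < p" "j < q" for s i j
    using int X[of s] that len unfolding A_def by (auto simp: list_all_length)
  moreover have "right_color (A s i j) = left_color (A (if Suc i < p then s else s') (Suc i mod p) j)"
    if ij: "i < p" "j < q" for s s' i j
  proof -
    have "map right_color (X s ! j) = tl (map left_color (X s ! j)) @ [left_color (hd (X s' ! j))]"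
      using int X[of s] X[of s'] ij len(1) by (auto simp: list_all2_conv_all_nth)
    then have "map right_color (X s ! j) ! i = (tl (map left_color (X s ! j)) @ [left_color (hd (X s' ! j))]) ! i"
      by simp
    then show ?thesis
      using map_tl_append_hd_nth[of i "X s ! j" "X s' ! j" left_color] ij len(2)[of j] ne(2)[of j]
      unfolding A_def by (auto split: if_splits)
  qed
  moreover have "top_color (A s i j) = bottom_color (A (if Suc j < q then s else s') i (Suc j mod q))"
    if ij: "i < p" "j < q" for s s' i j
  proof -
    have "map (map top_color) (X s) = tl (map (map bottom_color) (X s)) @ [map bottom_color (hd (X s'))]"
      using int X[of s] X[of s'] by blast
    then have "map (map top_color) (X s) ! j = (tl (map (map bottom_color) (X s)) @ [map bottom_color (hd (X s'))]) ! j"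
      by simp
    then have "map top_color (X s ! j) = map bottom_color ((if Suc j < q then X s else X s') ! (Suc j mod q))"
      using map_tl_append_hd_nth[of j "X s" "X s'" "map bottom_color"] ij len(1) ne(1) by simp
    then have "map top_color (X s ! j) ! i = map bottom_color ((if Suc j < q then X s else X s') ! (Suc j mod q)) ! i"
      by simp
    then show ?thesis using ij len(2) pq unfolding A_def by auto
  qed
  ultimately show ?thesis by (intro positive_if_interchangeable_blocks[of p q A])
qed

text \<open>Found by computer search: a set together with two interchangeable blocks over it.\<close>

definition certified_positive_sets :: "(nat list \<times> nat list list \<times> nat list list) list" where
  "certified_positive_sets = [
    ([1,2,5], [[1,1]], [[2,5]]),
    ([1,3,5,10], [[1,1],[1,1]], [[3,1],[10,5]]),
    ([1,3,6,14], [[1],[6]], [[3],[14]]),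
    ([1,4,5,10], [[1,1],[1,1]], [[4,5],[10,5]]),
    ([1,5,6,12], [[12,5,1]], [[12,6,5]]),
    ([1,6,7,10], [[10,6,7],[7,1,10]], [[10,7,1],[7,10,6]]),
    ([2,3,5,9], [[2,5],[2,5]], [[3,3],[9,9]]),
    ([2,3,5,10], [[10,5,2,5,3],[5,2,5,3,10],[3,2,5,10,5]], [[10,5,2,5,3],[5,3,2,5,10],[3,10,5,2,5]]),
    ([2,3,5,14], [[2,5],[5,2]], [[3,3],[14,14]]),
    ([2,4,5,10], [[2,5],[2,5]], [[4,5],[10,5]]),
    ([2,5,7,10], [[2,5],[5,2]], [[2,7],[5,10]]),
    ([4,5,10,12], [[10,5],[4,5]], [[12,5],[12,5]]),
    ([1,3,5,12,13], [[1,12,13],[3,12,5],[12,13,3],[13,3,12]], [[3,12,13],[12,13,1],[12,5,3],[13,3,12]]),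
    ([1,3,5,12,14], [[1,1,12,5],[3,3,12,5],[12,14,14,5],[12,5,3,3],[14,5,12,14]], [[1,3,12,5],[3,12,14,5],[12,14,5,1],[12,5,3,3],[14,5,12,14]]),
    ([1,3,6,12,13], [[1,3,12,13],[1,12,13,3],[6,13,3,12]], [[3,1,12,13],[12,6,13,3],[13,1,3,12]]),
    ([1,3,7,12,13], [[1,12,13],[1,12,7],[3,12,13],[12,13,3],[13,3,12]], [[3,12,13],[12,13,1],[12,7,1],[12,13,3],[13,3,12]]),
    ([1,4,5,12,14], [[1,12,5],[4,14,5],[14,5,4],[5,4,14]], [[4,14,5],[12,5,1],[14,5,4],[5,4,14]]),
    ([1,4,5,14,15], [[1,1,4,15],[5,4,14,14],[4,14,5,1],[14,5,1,4]], [[1,1,4,15],[5,4,14,14],[4,15,1,1],[14,14,5,4]]),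
    ([1,4,5,14,16], [[16,14,5,4],[14,5,4,16],[5,4,16,14],[4,16,14,5]], [[14,14,5,4],[5,1,4,16],[5,4,16,14],[4,16,14,5]]),
    ([1,4,7,10,13], [[1,1],[1,1]], [[4,7],[10,13]]),
    ([1,5,7,8,10], [[1,10,7],[7,1,10],[10,7,1]], [[1,10,7],[8,5,10],[10,7,1]]),
    ([1,5,7,10,12], [[1,10,7],[7,1,10],[10,7,1],[1,12,5]], [[1,10,7],[7,1,10],[12,5,1],[10,7,1]]),
    ([1,5,7,12,14], [[5,1,12],[5,1,12]], [[7,1,12],[14,5,12]]),
    ([1,6,7,12,13], [[6,7,12],[6,13,12]], [[7,1,12],[13,1,12]]),
    ([1,7,10,12,13], [[1,10,7],[7,1,10],[10,7,1],[1,12,7],[1,12,13]], [[1,10,7],[7,1,10],[12,7,1],[12,13,1],[10,7,1]]),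
    ([1,7,10,12,14], [[1,10,7],[7,1,10],[10,7,1]], [[1,12,7],[7,10,14],[10,7,1]]),
    ([1,7,12,13,14], [[7,1,1,12],[13,1,1,12],[7,1,1,12],[13,1,1,12]], [[7,1,1,12],[14,7,1,12],[7,12,7,12],[14,14,13,12]]),
    ([3,4,5,7,10], [[3,10,5,10,5],[10,5,4,5,3],[5,3,10,7,10]], [[3,10,7,10,5],[10,5,10,5,3],[5,4,5,3,10]]),
    ([3,4,5,8,10], [[5,10,5,3,10],[5,4,5,10,8]], [[5,10,8,5,10],[5,3,10,5,4]]),
    ([3,4,5,10,15], [[3,3],[10,15],[4,15],[10,15],[5,10]], [[4,5],[10,5],[3,3],[10,15],[5,10]]),
    ([3,5,7,8,10], [[7,10,5,10],[10,8,5,3]], [[7,10,7,10],[10,7,10,7]]),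
    ([3,5,7,10,12], [[3,10,5,12,5],[10,5,3,10,7],[5,3,10,7,10]], [[3,10,7,10,5],[10,5,12,5,3],[5,3,10,7,10]]),
    ([3,5,8,10,12], [[5,10,8,5,12],[5,3,10,5,12]], [[5,12,5,3,10],[5,12,5,10,8]]),
    ([3,5,8,10,15], [[3,3,10,5],[15,10,8,8],[10,5,10,15],[8,5,3,10],[10,8,15,3],[5,10,15,10]], [[3,3,10,5],[15,10,8,8],[10,5,10,15],[8,8,5,10],[10,15,3,3],[5,10,15,10]]),
    ([3,5,10,12,13], [[10,5],[3,3],[12,13]], [[12,5],[12,5],[12,5]]),
    ([3,5,10,12,14], [[3,10,5],[10,5,3],[5,3,12],[5,12,14]], [[3,10,5],[12,5,3],[14,5,12],[5,3,10]]),
    ([4,5,7,9,10], [[4,5],[10,5]], [[4,7],[9,9]]),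
    ([4,5,7,10,13], [[4,5],[10,5]], [[4,7],[10,13]]),
    ([4,5,7,10,15], [[4,5],[10,7],[5,10]], [[4,7],[10,15],[5,10]])]"

lemma interchangeable_certified:
  "\<forall>(N, R, R') \<in> set certified_positive_sets.
    interchangeable (map tile_of N) (map (map tile_of) R) (map (map tile_of) R')"
  by code_simp

section \<open>The symmetry group\<close>

lemma positive_image_if_array_count_le:
  "(\<And>M N. array_count M N B \<le> array_count M N B') \<Longrightarrow> positive B \<Longrightarrow> positive B'"
  unfolding positive_def by (meson of_nat_mono order_trans)

lemma positive_transpose: "positive B \<Longrightarrow> positive (transpose_tile ` B)"
proof -
  assume "positive B"
  then obtain \<delta> where d: "\<delta> > 0" "\<And>M N. exp (\<delta> * real M * real N) \<le> real (array_count M N B)"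
    unfolding positive_def by blast
  have "exp (\<delta> * real M * real N) \<le> real (array_count M N (transpose_tile ` B))" for M N
    using d(2)[of N M] by (simp add: array_count_transpose_eq mult_ac)
  then show ?thesis using d(1) unfolding positive_def by blast
qed

lemma positive_reflect: "positive B \<Longrightarrow> positive (reflect_tile ` B)"
  by (rule positive_image_if_array_count_le[OF array_count_reflect])

lemma positive_rotate: "positive B \<Longrightarrow> positive (rotate_tile ` B)"
proof -
  assume "positive B"
  then have "positive (reflect_tile ` transpose_tile ` B)" by (intro positive_reflect positive_transpose)
  moreover have "reflect_tile ` transpose_tile ` B = rotate_tile ` B"
    by (simp add: image_image reflect_tile_def transpose_tile_def rotate_tile_def)
  ultimately show ?thesis by simp
qed

lemma positive_recolor:
  assumes "bij \<eta>" "positive B"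
  shows "positive (recolor_horizontal \<eta> ` B)" "positive (recolor_vertical \<eta> ` B)"
  using positive_image_if_array_count_le[OF array_count_recolor(1)[OF assms(1)] assms(2)]
    positive_image_if_array_count_le[OF array_count_recolor(2)[OF assms(1)] assms(2)] .

lemma positive_funpow:
  assumes "\<And>B. positive B \<Longrightarrow> positive (f ` B)" "positive B"
  shows "positive ((f ^^ k) ` B)"
proof (induction k)
  case (Suc k)
  have "(f ^^ Suc k) ` B = f ` (f ^^ k) ` B" by (simp add: image_image)
  then show ?case using assms(1) Suc by simp
qed (use assms in simp)

text \<open>The maps behind \<open>tile_class\<close> as a list of 32 entries, so that equivalence
  classes can be computed.\<close>

definition symmetries :: "(wang_tile \<Rightarrow> wang_tile) list" where
  "symmetries = [recolor_vertical v \<circ> recolor_horizontal h \<circ> (reflect_tile ^^ i \<circ> rotate_tile ^^ k).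
     v \<leftarrow> [id, Not], h \<leftarrow> [id, Not], i \<leftarrow> [0..<2], k \<leftarrow> [0..<4]]"

lemma set_comprehension4:
  "set [f v h i k. v \<leftarrow> V, h \<leftarrow> H, i \<leftarrow> I, k \<leftarrow> K]
    = {f v h i k | v h i k. v \<in> set V \<and> h \<in> set H \<and> i \<in> set I \<and> k \<in> set K}"
  by auto

lemma set_symmetries:
  "set symmetries = {recolor_vertical v \<circ> recolor_horizontal h \<circ> (reflect_tile ^^ i \<circ> rotate_tile ^^ k) | v h i k.
     bij v \<and> bij h \<and> i < 2 \<and> k < 4}"
  unfolding symmetries_def set_comprehension4 bij_bool by simp

lemma tile_class_eq: "tile_class B = (\<lambda>g. g ` B) ` set symmetries"
proof -
  have "(recolor_vertical v \<circ> recolor_horizontal h \<circ> \<tau>) ` B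
     = recolor_vertical v ` recolor_horizontal h ` \<tau> ` B" for v h \<tau>
    by (simp add: image_image)
  note * = this[symmetric]
  show ?thesis unfolding tile_class_def set_symmetries dihedral4_def * by blast
qed

lemma positive_symmetry:
  assumes "g \<in> set symmetries" "positive B"
  shows "positive (g ` B)"
proof -
  obtain v h i k where g: "g = recolor_vertical v \<circ> recolor_horizontal h \<circ> (reflect_tile ^^ i \<circ> rotate_tile ^^ k)"
    and "bij v" "bij h"
    using assms(1) unfolding set_symmetries by blast
  then have "positive (recolor_vertical v ` recolor_horizontal h ` (reflect_tile ^^ i) ` (rotate_tile ^^ k) ` B)"
    using assms(2) by (intro positive_recolor positive_funpow positive_reflect positive_rotate)
  then show ?thesis unfolding g by (simp add: image_image)
qed

definition all_tiles :: "wang_tile list" where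
  "all_tiles = map tile_of [1..<17]"

lemma set_all_tiles [simp]: "set all_tiles = UNIV"
proof -
  have "T \<in> set all_tiles" for T
    unfolding all_tiles_def using tile_number_range[of T] by (force intro: image_eqI[of _ _ "tile_number T"])
  then show ?thesis by blast
qed

lemma map_all_tiles_eqD: "map f all_tiles = map g all_tiles \<Longrightarrow> f = g"
  by (auto simp: map_eq_conv)

text \<open>A map is represented by its values at the 16 tiles, which turns closure under
  composition and the existence of right inverses into comparisons of lists.\<close>

lemma symmetries_group_table:
  "let G = map (\<lambda>g. map g all_tiles) symmetries in
     list_all (\<lambda>g. list_all (\<lambda>h. List.member G (map g h)) G \<and> list_ex (\<lambda>h. map g h = all_tiles) G) symmetries"
  by code_simp

lemma symmetries_comp: "g \<in> set symmetries \<Longrightarrow> h \<in> set symmetries \<Longrightarrow> g \<circ> h \<in> set symmetries"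
proof -
  assume gh: "g \<in> set symmetries" "h \<in> set symmetries"
  then have "map g (map h all_tiles) \<in> set (map (\<lambda>g. map g all_tiles) symmetries)"
    using symmetries_group_table by (auto simp: Let_def list_all_iff list_ex_iff List.member_iff)
  then obtain k where "k \<in> set symmetries" "map (g \<circ> h) all_tiles = map k all_tiles" by auto
  then show ?thesis using map_all_tiles_eqD by metis
qed

lemma symmetries_inverse: "g \<in> set symmetries \<Longrightarrow> \<exists>h\<in>set symmetries. g \<circ> h = id"
proof -
  assume g: "g \<in> set symmetries"
  then obtain h where "h \<in> set symmetries" "map g (map h all_tiles) = all_tiles"
    using symmetries_group_table by (auto simp: Let_def list_all_iff list_ex_iff)
  then show ?thesis using map_all_tiles_eqD[of "g \<circ> h" id] by auto
qed

lemma symmetries_bij: "g \<in> set symmetries \<Longrightarrow> bij g"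
proof -
  assume "g \<in> set symmetries"
  then obtain h where "g \<circ> h = id" using symmetries_inverse by blast
  then have "g (h x) = x" for x by (metis comp_apply id_apply)
  then have "surj g" by (metis surjI)
  then show ?thesis using finite_UNIV_surj_inj[of g] by (simp add: bij_def)
qed

lemma tile_class_sym: "B' \<in> tile_class B \<Longrightarrow> B \<in> tile_class B'"
proof -
  assume "B' \<in> tile_class B"
  then obtain g where g: "g \<in> set symmetries" "B' = g ` B" unfolding tile_class_eq by blast
  obtain h where h: "h \<in> set symmetries" "g \<circ> h = id" using symmetries_inverse[OF g(1)] by blast
  \<comment> \<open>The right inverse is also a left inverse because \<open>g\<close> is
    injective.\<close>
  have "h \<circ> g = id"
  proof
    fix x
    have "g (h (g x)) = g x" using h(2) by (metis comp_apply id_apply)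
    then show "(h \<circ> g) x = id x" using symmetries_bij[OF g(1)] by (simp add: bij_def inj_eq)
  qed
  then have "B = h ` B'" unfolding g by (simp add: image_comp)
  then show ?thesis using h unfolding tile_class_eq by blast
qed

lemma tile_class_trans: "C \<in> tile_class B' \<Longrightarrow> B' \<in> tile_class B \<Longrightarrow> C \<in> tile_class B"
proof -
  assume "C \<in> tile_class B'" "B' \<in> tile_class B"
  then obtain g h where "g \<in> set symmetries" "h \<in> set symmetries" "C = g ` h ` B"
    unfolding tile_class_eq by blast
  then show "C \<in> tile_class B" using symmetries_comp unfolding tile_class_eq image_comp by blast
qed

lemma tile_class_cong: "B' \<in> tile_class B \<Longrightarrow> tile_class B' = tile_class B"
  using tile_class_sym tile_class_trans by blast

lemma tile_class_refl: "B \<in> tile_class B"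
proof -
  have "recolor_vertical id \<circ> recolor_horizontal id \<circ> (reflect_tile ^^ 0 \<circ> rotate_tile ^^ 0) \<in> set symmetries"
    unfolding set_symmetries by (blast intro: bij_id zero_less_numeral)
  moreover have "recolor_vertical id \<circ> recolor_horizontal id \<circ> (reflect_tile ^^ 0 \<circ> rotate_tile ^^ 0) = id"
    by (auto simp: recolor_vertical_def recolor_horizontal_def)
  ultimately have "id \<in> set symmetries" by simp
  then show ?thesis unfolding tile_class_eq by (intro image_eqI[of _ _ id]) simp_all
qed

lemma positive_tile_class:
  assumes "B' \<in> tile_class B"
  shows "positive B' \<longleftrightarrow> positive B"
proof -
  have "positive D" if "D \<in> tile_class C" "positive C" for C D
    using that(1) positive_symmetry[OF _ that(2)] unfolding tile_class_eq by auto
  then show ?thesis using assms tile_class_sym[OF assms] by blast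
qed

section \<open>Families of sets of tiles\<close>

text \<open>A family of subsets of a list of tiles is stored as a trie that branches on the membership of
  successive tiles. Only the minimal sets of a family matter: a leaf \<open>Full\<close> absorbs the supersets below it.\<close>

datatype family = Empty | Full | Node family family

text \<open>At a node, \<open>p\<close> holds the members without the tile \<open>hd ts\<close> and
  \<open>q\<close> those with it. A set containing that tile may still include a member from
  \<open>p\<close>, so the first disjunct carries no condition.\<close>

fun has_subset :: "family \<Rightarrow> wang_tile list \<Rightarrow> wang_tile set \<Rightarrow> bool" where
  "has_subset Empty ts X = False"
| "has_subset Full ts X = True"
| "has_subset (Node p q) ts X \<longleftrightarrow> has_subset p (tl ts) X \<or> hd ts \<in> X \<and> has_subset q (tl ts) X"

fun merge :: "family \<Rightarrow> family \<Rightarrow> family" where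
  "merge Full q = Full"
| "merge p Full = Full"
| "merge Empty q = q"
| "merge p Empty = p"
| "merge (Node p p') (Node q q') = Node (merge p q) (merge p' q')"

lemma has_subset_merge: "has_subset (merge p q) ts X \<longleftrightarrow> has_subset p ts X \<or> has_subset q ts X"
  by (induction p q arbitrary: ts rule: merge.induct) auto

fun height :: "family \<Rightarrow> nat" where
  "height (Node p q) = Suc (max (height p) (height q))"
| "height p = 0"

lemma height_merge: "height (merge p q) \<le> max (height p) (height q)"
  by (induction p q rule: merge.induct) auto

text \<open>Decides whether every set \<open>X\<close> includes a member of the first family or has a complement including
  a member of the second one, by deciding for one tile after the other whether it belongs to \<open>X\<close>.\<close>

function covers :: "family \<Rightarrow> family \<Rightarrow> bool" where
  "covers Full q = True"
| "covers Empty Full = True"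
| "covers (Node p p') Full = True"
| "covers Empty Empty = False"
| "covers Empty (Node q q') = covers Empty q"
| "covers (Node p p') Empty = covers p Empty"
| "covers (Node p p') (Node q q') \<longleftrightarrow> covers (merge p p') q \<and> covers p (merge q q')"
  by pat_completeness auto
termination
  by (relation "measure (\<lambda>(p, q). height p + height q)")
    (auto intro: le_less_trans[OF add_mono[OF height_merge order_refl]]
      le_less_trans[OF add_mono[OF order_refl height_merge]])

text \<open>If the current tile lies in \<open>X\<close>, both branches of the first family remain
  possible, hence the merge, while members of the second family containing the tile cannot fit into
  the complement. If it does not, the roles are exchanged.\<close>

lemma covers_sound: "covers p q \<Longrightarrow> has_subset p ts X \<or> has_subset q ts (- X)"
  by (induction p q arbitrary: ts rule: covers.induct) (auto simp: has_subset_merge)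

fun singleton_family :: "wang_tile list \<Rightarrow> wang_tile list \<Rightarrow> family" where
  "singleton_family ts [] = Full"
| "singleton_family [] (x # xs) = Empty"
| "singleton_family (t # ts) (x # xs) =
    (if t \<in> set (x # xs) then Node Empty (singleton_family ts (removeAll t (x # xs)))
     else Node (singleton_family ts (x # xs)) Empty)"

lemma has_subset_singleton_family:
  "set xs \<subseteq> set ts \<Longrightarrow> has_subset (singleton_family ts xs) ts X \<longleftrightarrow> set xs \<subseteq> X"
proof (induction ts xs rule: singleton_family.induct)
  case (3 t ts x xs)
  show ?case
  proof (cases "t \<in> set (x # xs)")
    case True
    have "set (removeAll t (x # xs)) \<subseteq> set ts" using "3.prems" by auto
    then show ?thesis using "3.IH"(1)[OF True] True by auto
  next
    case False
    then have "set (x # xs) \<subseteq> set ts" using "3.prems" by auto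
    then show ?thesis using "3.IH"(2)[OF False] False by simp
  qed
qed simp_all

definition family_of :: "wang_tile list list \<Rightarrow> family" where
  "family_of xss = fold (\<lambda>xs. merge (singleton_family all_tiles xs)) xss Empty"

lemma has_subset_family_of:
  "has_subset (family_of xss) all_tiles X \<longleftrightarrow> (\<exists>xs\<in>set xss. set xs \<subseteq> X)"
proof -
  have "has_subset (fold (\<lambda>xs. merge (singleton_family all_tiles xs)) xss p) all_tiles X
    \<longleftrightarrow> has_subset p all_tiles X \<or> (\<exists>xs\<in>set xss. set xs \<subseteq> X)" for p
    by (induction xss arbitrary: p) (auto simp: has_subset_merge has_subset_singleton_family)
  then show ?thesis unfolding family_of_def by simp
qed

text \<open>Closing the list under the symmetries reduces the search for an included equivalent to a
  plain inclusion test.\<close>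

definition class_family :: "wang_tile list list \<Rightarrow> family" where
  "class_family xss = family_of (concat (map (\<lambda>xs. map (\<lambda>g. map g xs) symmetries) xss))"

lemma has_subset_class_family:
  "has_subset (class_family xss) all_tiles X \<longleftrightarrow> (\<exists>xs\<in>set xss. \<exists>B\<in>tile_class (set xs). B \<subseteq> X)"
  unfolding class_family_def has_subset_family_of tile_class_eq by auto

section \<open>The classification\<close>

definition positive_sets :: "wang_tile list list" where
  "positive_sets = map (\<lambda>(N, R, R'). map tile_of N) certified_positive_sets"

definition zero_sets :: "wang_tile list list" where
  "zero_sets = map (map tile_of) [[1,4,5,14], [1,5,12,15,9,10,13,14], [1,5,12,16,9,10,13,14], [1,6,11,16,2,3,4,7,8,12], [1,6,12,15,9,10,13,14], [1,7,10,16,2,3,4,8,12], [1,7,12,13], [1,7,12,14], [2,5,12,15,9,10,13,14], [3,4,5,10], [3,5,7,10], [3,5,8,10], [3,5,10,12], [3,5,12,14], [4,5,7,10], [4,5,10,15], [4,7,10,13], [5,7,10,12]]"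

definition complement :: "wang_tile list \<Rightarrow> wang_tile list" where
  "complement xs = filter (\<lambda>T. T \<notin> set xs) all_tiles"

lemma set_complement [simp]: "set (complement xs) = - set xs"
  unfolding complement_def by auto

text \<open>Symmetries permute the tiles. Hence lying inside an equivalent of a set means that the
  complement includes an equivalent of its complement, and both lists are handled by inclusion
  tests.\<close>

lemma tile_class_Compl: "tile_class (- B) = uminus ` tile_class B"
  unfolding tile_class_eq image_image
  by (intro image_cong refl) (simp add: bij_image_Compl_eq symmetries_bij)

definition positive_family :: family where
  "positive_family = class_family positive_sets"

definition zero_family :: family where
  "zero_family = class_family (map complement zero_sets)"

lemma has_subset_positive_family:
  "has_subset positive_family all_tiles X \<longleftrightarrow> (\<exists>xs\<in>set positive_sets. \<exists>B\<in>tile_class (set xs). B \<subseteq> X)"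
  unfolding positive_family_def has_subset_class_family ..

lemma has_subset_zero_family:
  "has_subset zero_family all_tiles (- X) \<longleftrightarrow> (\<exists>xs\<in>set zero_sets. \<exists>B\<in>tile_class (set xs). X \<subseteq> B)"
  unfolding zero_family_def has_subset_class_family by (simp add: tile_class_Compl)

lemma positive_positive_sets: "xs \<in> set positive_sets \<Longrightarrow> positive (set xs)"
  using interchangeable_certified positive_if_interchangeable unfolding positive_sets_def by fastforce

text \<open>Up to symmetry these four weights suffice for \<open>tl zero_sets\<close>. The pair
  \<open>(0, 0)\<close> stands for the sets in which bottom and left colors always determine the
  tile.\<close>

definition zero_by_weight :: "wang_tile list \<Rightarrow> bool" where
  "zero_by_weight xs \<longleftrightarrow> (\<exists>(\<alpha>, \<beta>) \<in> set [(0, 0), (-1, 0), (1, 1), (2, 1)].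
     list_all (\<lambda>T. tile_weight \<alpha> \<beta> T \<ge> 0) xs \<and>
     distinct (map (\<lambda>T. (bottom_color T, left_color T)) (filter (\<lambda>T. tile_weight \<alpha> \<beta> T = 0) xs)))"

lemma not_positive_if_zero_by_weight: "zero_by_weight xs \<Longrightarrow> \<not> positive (set xs)"
proof -
  assume "zero_by_weight xs"
  then obtain \<alpha> \<beta> where "list_all (\<lambda>T. tile_weight \<alpha> \<beta> T \<ge> 0) xs"
      "distinct (map (\<lambda>T. (bottom_color T, left_color T)) (filter (\<lambda>T. tile_weight \<alpha> \<beta> T = 0) xs))"
    unfolding zero_by_weight_def by blast
  then show "\<not> positive (set xs)"
    by (intro not_positive_if_weight[of _ \<alpha> \<beta>]) (auto simp: list_all_iff distinct_map)
qed

text \<open>\<open>tl\<close> drops the set {1,4,5,14}, which is treated by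
  \<open>not_positive_diagonal\<close>.\<close>

lemma zero_sets_by_weight:
  "list_all (\<lambda>xs. list_ex (\<lambda>g. zero_by_weight (map g xs)) symmetries) (tl zero_sets)"
  by code_simp

lemma hd_zero_sets:
  "zero_sets = map tile_of [1, 4, 5, 14] # tl zero_sets"
  unfolding zero_sets_def by simp

lemma not_positive_zero_sets: "xs \<in> set zero_sets \<Longrightarrow> \<not> positive (set xs)"
proof -
  assume "xs \<in> set zero_sets"
  then consider "xs = map tile_of [1, 4, 5, 14]" | "xs \<in> set (tl zero_sets)"
    by (subst (asm) hd_zero_sets) auto
  then show ?thesis
  proof cases
    case 1
    have "\<not> positive (set (map tile_of [1, 4, 5, 14]))"
      by (rule not_positive_diagonal[OF _ refl]) (simp add: tile_of_def)
    then show ?thesis using 1 by simp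
  next
    case 2
    then obtain g where g: "g \<in> set symmetries" "zero_by_weight (map g xs)"
      using zero_sets_by_weight by (auto simp: list_all_iff list_ex_iff)
    have "\<not> positive (g ` set xs)" using not_positive_if_zero_by_weight[OF g(2)] by simp
    moreover have "g ` set xs \<in> tile_class (set xs)" using g(1) unfolding tile_class_eq by blast
    ultimately show ?thesis using positive_tile_class by blast
  qed
qed

text \<open>The dichotomy that makes both lists complete, evaluated on tries: every set includes an
  equivalent of a member of \<open>positive_sets\<close> or lies inside an equivalent of a member of
  \<open>zero_sets\<close>.\<close>

lemma covers_positive_zero: "covers positive_family zero_family"
  by code_simp

text \<open>By monotonicity a positive set lies inside no equivalent of a zero set, so the dichotomy
  leaves the inclusion. Positivity thereby becomes a matter of evaluation.\<close>

lemma positive_iff_has_subset: "positive X \<longleftrightarrow> has_subset positive_family all_tiles X"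
proof
  assume "has_subset positive_family all_tiles X"
  then show "positive X"
    unfolding has_subset_positive_family
    using positive_positive_sets positive_tile_class positive_mono by metis
next
  assume pos: "positive X"
  have "\<not> has_subset zero_family all_tiles (- X)"
  proof
    assume "has_subset zero_family all_tiles (- X)"
    then obtain xs B where "xs \<in> set zero_sets" "B \<in> tile_class (set xs)" "X \<subseteq> B"
      unfolding has_subset_zero_family by blast
    then show False using not_positive_zero_sets positive_tile_class positive_mono[OF pos] by blast
  qed
  then show "has_subset positive_family all_tiles X" using covers_sound[OF covers_positive_zero] by blast
qed

section \<open>Minimality, saturation and inequivalence of the listed sets\<close>

text \<open>Monotonicity reduces all proper subsets to those missing a single tile; dually,
  \<open>saturated_in\<close> adds a single tile.\<close>

definition minimal_in :: "family \<Rightarrow> wang_tile list list \<Rightarrow> bool" where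
  "minimal_in F xss \<longleftrightarrow> list_all (\<lambda>xs. list_all (\<lambda>x. \<not> has_subset F all_tiles (set (removeAll x xs))) xs) xss"

definition saturated_in :: "family \<Rightarrow> wang_tile list list \<Rightarrow> bool" where
  "saturated_in F xss \<longleftrightarrow> list_all (\<lambda>xs. list_all (\<lambda>x. has_subset F all_tiles (set (x # xs))) (complement xs)) xss"

lemma positive_sets_minimal: "minimal_in positive_family positive_sets"
  by code_simp

lemma zero_sets_saturated: "saturated_in positive_family zero_sets"
  by code_simp

definition avoids :: "family \<Rightarrow> wang_tile list list \<Rightarrow> bool" where
  "avoids F xss \<longleftrightarrow> list_all (\<lambda>xs. \<not> has_subset F all_tiles (set xs)) xss"

text \<open>A stronger condition than inequivalence: no set even includes an equivalent of an
  earlier one, which reuses the inclusion test.\<close>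

fun pairwise_inequivalent :: "wang_tile list list \<Rightarrow> bool" where
  "pairwise_inequivalent [] = True"
| "pairwise_inequivalent (xs # xss) \<longleftrightarrow> avoids (class_family [xs]) xss \<and> pairwise_inequivalent xss"

lemma card_tile_classes:
  "pairwise_inequivalent xss \<Longrightarrow> card ((\<lambda>xs. tile_class (set xs)) ` set xss) = length xss"
proof -
  assume "pairwise_inequivalent xss"
  then have "distinct (map (\<lambda>xs. tile_class (set xs)) xss)"
  proof (induction xss)
    case (Cons xs xss)
    have "tile_class (set xs) \<noteq> tile_class (set ys)" if "ys \<in> set xss" for ys
    proof
      assume "tile_class (set xs) = tile_class (set ys)"
      then have "set ys \<in> tile_class (set xs)" using tile_class_refl by simp
      moreover have "\<not> has_subset (class_family [xs]) all_tiles (set ys)"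
        using Cons.prems that by (simp add: avoids_def list_all_iff)
      ultimately show False unfolding has_subset_class_family by auto
    qed
    then show ?case using Cons by auto
  qed simp
  then show ?thesis by (metis distinct_card length_map set_map)
qed

lemma pairwise_inequivalent_sets:
  "pairwise_inequivalent positive_sets" "pairwise_inequivalent zero_sets"
  by code_simp+

lemma entropy_zero_iff: "entropy B = 0 \<longleftrightarrow> \<not> positive B"
  using entropy_positive_iff[of B] entropy_nonneg[of B] by linarith

lemma marginal_positive_entropy_iff:
  "marginal_positive_entropy B \<longleftrightarrow> positive B \<and> (\<forall>B'. B' \<subset> B \<longrightarrow> \<not> positive B')"
  unfolding marginal_positive_entropy_def entropy_zero_iff entropy_positive_iff ..

lemma saturated_zero_entropy_iff:
  "saturated_zero_entropy B \<longleftrightarrow> \<not> positive B \<and> (\<forall>B'. B \<subset> B' \<longrightarrow> positive B')"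
  unfolding saturated_zero_entropy_def entropy_zero_iff entropy_positive_iff ..

text \<open>A marginal set includes an equivalent of a listed set; the latter is positive, so
  minimality makes the two equal.\<close>

lemma marginal_positive_entropy_classes:
  "tile_class ` {B. marginal_positive_entropy B} = (\<lambda>xs. tile_class (set xs)) ` set positive_sets"
proof (intro equalityI image_subsetI)
  fix B assume "B \<in> {B. marginal_positive_entropy B}"
  then have B: "positive B" "\<And>B'. B' \<subset> B \<Longrightarrow> \<not> positive B'" unfolding marginal_positive_entropy_iff by auto
  then obtain xs A where xs: "xs \<in> set positive_sets" "A \<in> tile_class (set xs)" "A \<subseteq> B"
    unfolding positive_iff_has_subset has_subset_positive_family by blast
  then have "positive A" using positive_positive_sets positive_tile_class by blast
  then have "A = B" using B(2)[of A] xs(3) by blast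
  then show "tile_class B \<in> (\<lambda>xs. tile_class (set xs)) ` set positive_sets"
    using tile_class_cong[OF xs(2)] xs(1) by blast
next
  fix xs assume xs: "xs \<in> set positive_sets"
  have "\<not> positive A" if A: "A \<subset> set xs" for A
  proof -
    obtain x where "x \<in> set xs" "x \<notin> A" using A by blast
    then have "x \<in> set xs" "A \<subseteq> set (removeAll x xs)" using A by auto
    moreover from this(1) have "\<not> positive (set (removeAll x xs))"
      using positive_sets_minimal xs unfolding minimal_in_def list_all_iff positive_iff_has_subset by blast
    ultimately show ?thesis using positive_mono by blast
  qed
  then have "marginal_positive_entropy (set xs)"
    using positive_positive_sets[OF xs] unfolding marginal_positive_entropy_iff by blast
  then show "tile_class (set xs) \<in> tile_class ` {B. marginal_positive_entropy B}" by blast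
qed

text \<open>Dually, the dichotomy places a saturated set inside an equivalent of a listed set; the
  latter is not positive, so saturation makes the two equal.\<close>

lemma saturated_zero_entropy_classes:
  "tile_class ` {B. saturated_zero_entropy B} = (\<lambda>xs. tile_class (set xs)) ` set zero_sets"
proof (intro equalityI image_subsetI)
  fix B assume "B \<in> {B. saturated_zero_entropy B}"
  then have B: "\<not> positive B" "\<And>B'. B \<subset> B' \<Longrightarrow> positive B'" unfolding saturated_zero_entropy_iff by auto
  then have "has_subset zero_family all_tiles (- B)"
    using covers_sound[OF covers_positive_zero] positive_iff_has_subset by blast
  then obtain xs A where xs: "xs \<in> set zero_sets" "A \<in> tile_class (set xs)" "B \<subseteq> A"
    unfolding has_subset_zero_family by blast
  then have "\<not> positive A" using not_positive_zero_sets positive_tile_class by blast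
  then have "A = B" using B(2)[of A] xs(3) by blast
  then show "tile_class B \<in> (\<lambda>xs. tile_class (set xs)) ` set zero_sets"
    using tile_class_cong[OF xs(2)] xs(1) by blast
next
  fix xs assume xs: "xs \<in> set zero_sets"
  have "positive A" if A: "set xs \<subset> A" for A
  proof -
    obtain x where "x \<notin> set xs" "x \<in> A" using A by blast
    then have "x \<in> set (complement xs)" "set (x # xs) \<subseteq> A" using A by auto
    moreover from this(1) have "positive (set (x # xs))"
      using zero_sets_saturated xs unfolding saturated_in_def list_all_iff positive_iff_has_subset by blast
    ultimately show ?thesis using positive_mono by blast
  qed
  then have "saturated_zero_entropy (set xs)"
    using not_positive_zero_sets[OF xs] unfolding saturated_zero_entropy_iff by blast
  then show "tile_class (set xs) \<in> tile_class ` {B. saturated_zero_entropy B}" by blast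
qed

text \<open>Passes from the lists used for evaluation to the sets of numbers of the classification.
  The range matters because \<open>tile_of\<close> inverts \<open>tile_number\<close> only
  there.\<close>

lemma tile_class_tiles_image:
  assumes "\<forall>N\<in>set Ns. \<forall>n\<in>set N. 1 \<le> n \<and> n \<le> 16"
  shows "(\<lambda>xs. tile_class (set xs)) ` set (map (map tile_of) Ns) = (\<lambda>N. tile_class (tiles N)) ` set ` set Ns"
proof -
  have "set N \<subseteq> {1..16}" if "N \<in> set Ns" for N using assms that by auto
  then show ?thesis unfolding set_map image_image by (intro image_cong refl) (simp only: tiles_eq set_map)
qed

theorem theorem1p2:
  shows "tile_class ` {B. marginal_positive_entropy B} =
      (\<lambda>N. tile_class (tiles N)) `
        {{1,2,5}, {1,3,5,10}, {1,3,6,14}, {1,4,5,10}, {1,5,6,12},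
         {1,6,7,10}, {2,3,5,9}, {2,3,5,10}, {2,3,5,14}, {2,4,5,10},
         {2,5,7,10}, {4,5,10,12}, {1,3,5,12,13}, {1,3,5,12,14}, {1,3,6,12,13},
         {1,3,7,12,13}, {1,4,5,12,14}, {1,4,5,14,15}, {1,4,5,14,16}, {1,4,7,10,13},
         {1,5,7,8,10}, {1,5,7,10,12}, {1,5,7,12,14}, {1,6,7,12,13}, {1,7,10,12,13},
         {1,7,10,12,14}, {1,7,12,13,14}, {3,4,5,7,10}, {3,4,5,8,10}, {3,4,5,10,15},
         {3,5,7,8,10}, {3,5,7,10,12}, {3,5,8,10,12}, {3,5,8,10,15}, {3,5,10,12,13},
         {3,5,10,12,14}, {4,5,7,9,10}, {4,5,7,10,13}, {4,5,7,10,15}}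
    \<and> card (tile_class ` {B. marginal_positive_entropy B}) = 39
    \<and> tile_class ` {B. saturated_zero_entropy B} =
      (\<lambda>N. tile_class (tiles N)) `
        {{1,4,5,14}, {1,5,12,15} \<union> {9,10,13,14}, {1,5,12,16} \<union> {9,10,13,14},
         {1,6,11,16} \<union> {2,3,4,7,8,12}, {1,6,12,15} \<union> {9,10,13,14}, {1,7,10,16} \<union> {2,3,4,8,12},
         {1,7,12,13}, {1,7,12,14}, {2,5,12,15} \<union> {9,10,13,14},
         {3,4,5,10}, {3,5,7,10}, {3,5,8,10},
         {3,5,10,12}, {3,5,12,14}, {4,5,7,10},
         {4,5,10,15}, {4,7,10,13}, {5,7,10,12}}
    \<and> card (tile_class ` {B. saturated_zero_entropy B}) = 18"
proof (intro conjI, goal_cases)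
  case 1
  have Ns: "positive_sets = map (map tile_of) (map fst certified_positive_sets)"
    unfolding positive_sets_def by (simp add: case_prod_unfold)
  show ?case
    unfolding marginal_positive_entropy_classes Ns
    by (subst tile_class_tiles_image) (simp_all add: certified_positive_sets_def)
next
  case 2
  show ?case
    unfolding marginal_positive_entropy_classes card_tile_classes[OF pairwise_inequivalent_sets(1)]
    by (simp add: positive_sets_def certified_positive_sets_def)
next
  case 3
  show ?case
    unfolding saturated_zero_entropy_classes zero_sets_def
    \<comment> \<open>Without \<open>Un_insert_right\<close> the unions unfold from the left only,
      in the order of the entries of \<open>zero_sets\<close>.\<close>
    by (subst tile_class_tiles_image) (simp_all del: Un_insert_right)
next
  case 4
  show ?case
    unfolding saturated_zero_entropy_classes card_tile_classes[OF pairwise_inequivalent_sets(2)]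
    by (simp add: zero_sets_def)
qed

end
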